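(* There are infinitely many linearly independent radial Schwartz functions $f:\mathbb R^2\to\mathbb C$ such that both $f$ and $\mathcal F(f)$ vanish of order $2$ at every radius $\sqrt{2n/\sqrt3}$, where $n$ ranges over all integers of the form $n=x^2+xy+y^2$ with $x,y\in\mathbb Z$.
   Context: Fourier transform: $\mathcal F(f)(\xi)=\int_{\mathbb R^2}f(x)e^{2\pi i\langle x,\xi\rangle}dx$. A radial function $g(x)=G(|x|^2)$ vanishes of order $2$ at radius $\sqrt{t}$ if $G(t)=G'(t)=0$ (derivative with respect to $u=|x|^2$). *)

theory Defs
  imports "HOL-Analysis.Analysis" "HOL-Library.Function_Algebras"
begin

text \<open>
  For a list of basis vectors, \<open>iter_partial\<close> is the corresponding iterated partial derivative.
  The underlying \<open>frechet_derivative\<close> is only meaningful at points of differentiability,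
  so \<open>schwartz\<close> demands differentiability at every order separately.
\<close>

primrec iter_partial ::
  "'a::euclidean_space list \<Rightarrow> ('a \<Rightarrow> complex) \<Rightarrow> 'a \<Rightarrow> complex" where
  "iter_partial [] f = f"
| "iter_partial (b # bs) f = (\<lambda>x. frechet_derivative (iter_partial bs f) (at x) b)"

definition schwartz :: "('a::euclidean_space \<Rightarrow> complex) \<Rightarrow> bool" where
  "schwartz f \<longleftrightarrow>
     (\<forall>bs. set bs \<subseteq> Basis \<longrightarrow>
        (\<forall>x. iter_partial bs f differentiable (at x)) \<and>
        (\<forall>k::nat. bounded (range (\<lambda>x. norm x ^ k * norm (iter_partial bs f x)))))"

text \<open>Kernel with exponent \<open>+2\<pi>i\<close>, opposite to the more common sign convention.\<close>

definition fourier :: "(real^2 \<Rightarrow> complex) \<Rightarrow> real^2 \<Rightarrow> complex" where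
  "fourier f \<xi> =
     (LINT x|lborel. f x * exp (2 * complex_of_real pi * \<i> * complex_of_real (x \<bullet> \<xi>)))"

definition radial :: "(real^2 \<Rightarrow> complex) \<Rightarrow> bool" where
  "radial g \<longleftrightarrow> (\<exists>G :: real \<Rightarrow> complex. \<forall>x. g x = G ((norm x)\<^sup>2))"

text \<open>
  The profile \<open>G\<close> is determined by \<open>g\<close> on \<open>[0, \<infinity>)\<close> only, so the derivative is taken within
  that set; this matters only at radius 0, where it is the right-hand derivative.
\<close>

definition vanishes_order2_at_radius :: "(real^2 \<Rightarrow> complex) \<Rightarrow> real \<Rightarrow> bool" where
  "vanishes_order2_at_radius g r \<longleftrightarrow>
     (\<exists>G :: real \<Rightarrow> complex. (\<forall>x. g x = G ((norm x)\<^sup>2)) \<and>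
        G (r\<^sup>2) = 0 \<and> (G has_vector_derivative 0) (at (r\<^sup>2) within {0..}))"

interpretation cfun: vector_space "\<lambda>(c::complex) (f :: real^2 \<Rightarrow> complex) x. c * f x"
  by unfold_locales (simp_all add: fun_eq_iff algebra_simps)

end

theory Submission
  imports Defs "HOL-Probability.Characteristic_Functions" "HOL-Complex_Analysis.Complex_Analysis"
begin

text \<open>
  Put \<open>u = \<bar>x\<bar>\<^sup>2\<close> and \<open>node n = 2n/\<surd>3\<close>. Integers of the form \<open>x\<^sup>2 + xy + y\<^sup>2\<close> lie in five residue
  classes modulo 9, and \<open>5/9 < 1/\<surd>3\<close> makes double zeros at all nodes in these classes a subcritical
  requirement: there is a trigonometric polynomial \<open>P(u)\<close> with these double zeros and with frequencies
  \<open>\<pi>\<sigma>\<close>, \<open>\<bar>\<sigma>\<bar> < 1\<close>. The functions \<open>P(u)/(u - node n)\<^sup>2\<close> and \<open>P(u)/(u - node n)\<close> are superpositions of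
  \<open>e\<^bsup>i\<pi>\<sigma>u\<^esup>\<close> with \<open>\<bar>\<sigma>\<bar> < 1\<close> and solve the Hermite interpolation problem at the nodes.

  Multiplied by \<open>e\<^bsup>-\<pi>\<epsilon>u\<^esup>\<close>, they become superpositions of the Gaussians \<open>e\<^bsup>i\<pi>\<tau>u\<^esup>\<close> with \<open>\<tau> = \<sigma> + i\<epsilon>\<close>, and the
  Fourier transform replaces \<open>\<tau>\<close> by \<open>-1/\<tau>\<close>, whose imaginary part is larger than \<open>\<epsilon>\<close> because
  \<open>\<bar>\<tau>\<bar> < 1\<close>. So the Fourier transforms are exponentially smaller at distant nodes, and for the
  self-dual functions \<open>h + \<F>h\<close> the interpolation problem at all nodes beyond some radius is solved by
  a contraction argument. Prescribing a nonzero value at one node \<open>n \<equiv> 55\<close> modulo 225, which is in an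
  admissible class but not of the form \<open>x\<^sup>2 + xy + y\<^sup>2\<close>, gives infinitely many independent functions,
  and the finitely many remaining nodes cost finitely many dimensions.
\<close>

section \<open>The Fourier transform of a complex Gaussian in the plane\<close>

text \<open>One coordinate factor of the Gaussian Fourier integral. The parameter \<open>b\<close>
  is complex because it is used at b = -i pi tau.\<close>

definition gauss1 :: "complex \<Rightarrow> real \<Rightarrow> complex" where
  "gauss1 b s = (LINT x|lborel. exp (- b * of_real (x\<^sup>2) + \<i> * of_real (s * x)))"

lemma integrable_real_gauss:
  assumes "0 < d"
  shows "integrable lborel (\<lambda>x::real. exp (- d * x\<^sup>2))"
proof -
  have "integrable lborel (\<lambda>x::real. normal_density 0 (1 / sqrt (2 * d)) x)"
    by (rule integrable_normal_density) (use assms in simp)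
  then have "integrable lborel (\<lambda>x. sqrt (pi / d) * normal_density 0 (1 / sqrt (2 * d)) x)"
    by (rule integrable_mult_right)
  moreover have "sqrt (pi / d) * normal_density 0 (1 / sqrt (2 * d)) x = exp (- d * x\<^sup>2)" for x
    using assms by (simp add: normal_density_def power_divide real_sqrt_divide field_simps)
  ultimately show ?thesis by simp
qed

lemma norm_gauss_integrand:
  "norm (exp (- b * of_real (x\<^sup>2) + \<i> * of_real (s * x)) :: complex) = exp (- Re b * x\<^sup>2)"
  by (simp add: norm_exp_eq_Re)

lemma integrable_gauss1:
  assumes "0 < Re b"
  shows "integrable lborel (\<lambda>x::real. exp (- b * of_real (x\<^sup>2) + \<i> * of_real (s * x)))"
proof (rule Bochner_Integration.integrable_bound[OF integrable_real_gauss[OF assms]])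
  show "(\<lambda>x::real. exp (- b * of_real (x\<^sup>2) + \<i> * of_real (s * x))) \<in> borel_measurable lborel"
    by measurable
qed (simp add: norm_gauss_integrand)

text \<open>The rescaling by c with 2 b c^2 = 1 turns the integral into the characteristic function
  of the standard normal distribution.\<close>

lemma gauss1_of_real:
  assumes "0 < b"
  shows "gauss1 (of_real b) s = of_real (sqrt (pi / b) * exp (- s\<^sup>2 / (4 * b)))"
proof -
  define c where "c = 1 / sqrt (2 * b)"
  have c: "c > 0" "c\<^sup>2 = 1 / (2 * b)"
    using assms by (auto simp: c_def power_divide)
  have "gauss1 (of_real b) s = c *\<^sub>R (LINT x|lborel. exp (- b * of_real ((c * x)\<^sup>2) + \<i> * of_real (s * (c * x))))"
    unfolding gauss1_def using c(1) by (subst lborel_integral_real_affine[where c = c and t = 0]) auto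
  also have "(\<lambda>x::real. exp (- b * of_real ((c * x)\<^sup>2) + \<i> * of_real (s * (c * x)))) =
       (\<lambda>x::real. of_real (sqrt (2 * pi)) * (std_normal_density x *\<^sub>R iexp (s * c * x)))"
  proof
    fix x :: real
    have *: "b * (c * x)\<^sup>2 = x\<^sup>2 / 2" using c(2) assms by (simp add: power_mult_distrib)
    show "exp (- b * of_real ((c * x)\<^sup>2) + \<i> * of_real (s * (c * x))) =
       of_real (sqrt (2 * pi)) * (std_normal_density x *\<^sub>R iexp (s * c * x))"
      unfolding exp_add
      by (simp add: std_normal_density_def scaleR_conv_of_real exp_of_real[symmetric] mult.assoc
          flip: of_real_mult of_real_power of_real_minus) (simp add: * del: of_real_minus)
  qed
  also have "(LINT x|lborel. of_real (sqrt (2 * pi)) * (std_normal_density x *\<^sub>R iexp (s * c * x))) =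
       of_real (sqrt (2 * pi)) * char std_normal_distribution (s * c)"
    unfolding char_def by (subst integral_mult_right_zero) (simp add: integral_density)
  also have "\<dots> = of_real (sqrt (2 * pi) * exp (- s\<^sup>2 / (4 * b)))"
    using c(2) by (simp add: char_std_normal_distribution power_mult_distrib)
  also have "c *\<^sub>R \<dots> = of_real (sqrt (pi / b) * exp (- s\<^sup>2 / (4 * b)))"
    by (simp add: c_def scaleR_conv_of_real real_sqrt_divide real_sqrt_mult)
  finally show ?thesis .
qed

text \<open>Dominated convergence: each point eventually leaves the tail set. The tail depends on
  \<open>d\<close> alone, so it gives uniform convergence wherever Re b >= d.\<close>

lemma gauss1_tail:
  assumes "0 < d"
  shows "(\<lambda>n::nat. LINT x|lborel. indicator (- {- real n..real n}) x *\<^sub>R exp (- d * x\<^sup>2)) \<longlonglongrightarrow> (0::real)"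
proof -
  have "(\<lambda>n::nat. LINT x|lborel. indicator (- {- real n..real n}) x *\<^sub>R exp (- d * x\<^sup>2)) \<longlonglongrightarrow> (LINT (x::real)|lborel. (0::real))"
  proof (rule Bochner_Integration.integral_dominated_convergence[where w = "\<lambda>x. exp (- d * x\<^sup>2)"])
    show "AE x in lborel. (\<lambda>n::nat. indicator (- {- real n..real n}) x *\<^sub>R exp (- d * x\<^sup>2)) \<longlonglongrightarrow> 0"
    proof (rule AE_I2, rule tendsto_eventually)
      fix x :: real
      obtain N :: nat where "\<bar>x\<bar> \<le> real N" using real_arch_simple by blast
      then show "\<forall>\<^sub>F n in sequentially. indicator (- {- real n..real n}) x *\<^sub>R exp (- d * x\<^sup>2) = 0"
        by (intro eventually_sequentiallyI[of N]) (auto simp: indicator_def)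
    qed
  qed (use integrable_real_gauss[OF assms] in \<open>auto simp: indicator_def\<close>)
  then show ?thesis by simp
qed

text \<open>Integrals over compact intervals are holomorphic by differentiation under the integral
  sign, and locally uniform limits of holomorphic functions are holomorphic.\<close>

lemma gauss1_holomorphic: "(\<lambda>b. gauss1 b s) holomorphic_on {b. 0 < Re b}"
proof (rule holomorphic_uniform_sequence)
  define g where "g b x = exp (- b * of_real (x\<^sup>2) + \<i> * of_real (s * x))" for b :: complex and x :: real
  define f where "f n b = integral (cbox (- real n) (real n)) (g b)" for n :: nat and b
  show "open {b. 0 < Re b}" by (rule open_halfspace_Re_gt)
  show "f n holomorphic_on {b. 0 < Re b}" for n
    unfolding f_def
  proof (rule leibniz_rule_holomorphic)
    show "((\<lambda>b. g b t) has_field_derivative (- of_real (t\<^sup>2) * g b t)) (at b within {b. 0 < Re b})" for b t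
      unfolding g_def by (auto intro!: derivative_eq_intros)
    show "g b integrable_on cbox (- real n) (real n)" for b
      unfolding g_def by (intro integrable_continuous continuous_intros)
    show "continuous_on ({b. 0 < Re b} \<times> cbox (- real n) (real n)) (\<lambda>(b, t). - of_real (t\<^sup>2) * g b t)"
      unfolding g_def case_prod_unfold by (intro continuous_intros)
    show "convex {b. 0 < Re b}" by (rule convex_halfspace_Re_gt)
  qed
  fix b0 :: complex assume b0: "b0 \<in> {b. 0 < Re b}"
  \<comment> \<open>On the ball of this radius the real part stays at least d, so e^(-d x^2)
    dominates all integrands at once.\<close>
  define d where "d = Re b0 / 2"
  have d: "d > 0" using b0 by (simp add: d_def)
  have Re_ge: "d \<le> Re b" if "b \<in> cball b0 d" for b
  proof -
    have "Re (b0 - b) \<le> d" using complex_Re_le_cmod[of "b0 - b"] that by (simp add: dist_norm)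
    then show ?thesis by (simp add: d_def)
  qed
  have diff: "norm (f n b - gauss1 b s) \<le> (LINT x|lborel. indicator (- {- real n..real n}) x *\<^sub>R exp (- d * x\<^sup>2))"
    if "b \<in> cball b0 d" for n b
  proof -
    have b: "0 < Re b" using Re_ge[OF that] d by simp
    have int: "integrable lborel (g b)" unfolding g_def by (rule integrable_gauss1[OF b])
    have int1: "set_integrable lborel {- real n..real n} (g b)" 
      unfolding set_integrable_def by (rule integrable_mult_indicator[OF _ int]) simp
    have int2: "set_integrable lborel (- {- real n..real n}) (g b)" 
      unfolding set_integrable_def by (rule integrable_mult_indicator[OF _ int]) simp
    have int3: "integrable lborel (\<lambda>x. indicator (- {- real n..real n}) x *\<^sub>R exp (- d * x\<^sup>2))" 
      by (rule integrable_mult_indicator[OF _ integrable_real_gauss[OF d]]) simp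
    have "f n b = (LINT x:{- real n..real n}|lborel. g b x)"
      unfolding f_def using set_borel_integral_eq_integral(2)[OF int1] by simp
    moreover have "gauss1 b s = (LINT x:{- real n..real n}|lborel. g b x) + (LINT x:(- {- real n..real n})|lborel. g b x)"
      using set_integral_Un[OF _ int1 int2] by (simp add: gauss1_def g_def set_lebesgue_integral_def)
    ultimately have "norm (f n b - gauss1 b s) = norm (LINT x:(- {- real n..real n})|lborel. g b x)"
      by (simp add: norm_minus_commute)
    also have "\<dots> \<le> (LINT x|lborel. indicator (- {- real n..real n}) x *\<^sub>R exp (- d * x\<^sup>2))"
      unfolding set_lebesgue_integral_def
    proof (rule Bochner_Integration.integral_norm_bound_integral[OF int2[unfolded set_integrable_def] int3])
      fix x
      have "norm (g b x) \<le> exp (- d * x\<^sup>2)"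
        unfolding g_def norm_gauss_integrand using mult_right_mono[OF Re_ge[OF that], of "x\<^sup>2"] by simp
      then show "norm (indicator (- {- real n..real n}) x *\<^sub>R g b x) \<le> indicator (- {- real n..real n}) x *\<^sub>R exp (- d * x\<^sup>2)"
        by (simp add: indicator_def)
    qed
    finally show ?thesis .
  qed
  have "uniform_limit (cball b0 d) f (\<lambda>b. gauss1 b s) sequentially"
  proof (rule uniform_limitI)
    fix e :: real assume "e > 0"
    with gauss1_tail[OF d] have "\<forall>\<^sub>F n::nat in sequentially. dist (LINT x|lborel. indicator (- {- real n..real n}) x *\<^sub>R exp (- d * x\<^sup>2)) 0 < e"
      by (rule tendstoD)
    then show "\<forall>\<^sub>F n in sequentially. \<forall>b\<in>cball b0 d. dist (f n b) (gauss1 b s) < e"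
    proof eventually_elim
      case (elim n)
      show ?case
      proof
        fix b assume "b \<in> cball b0 d"
        from diff[OF this, of n] elim show "dist (f n b) (gauss1 b s) < e"
          unfolding dist_norm by simp
      qed
    qed
  qed
  moreover have "cball b0 d \<subseteq> {b. 0 < Re b}" using Re_ge d by fastforce
  ultimately show "\<exists>d>0. cball b0 d \<subseteq> {b. 0 < Re b} \<and> uniform_limit (cball b0 d) f (\<lambda>b. gauss1 b s) sequentially"
    using d by blast
qed

text \<open>The exponent is a sum over the coordinates, so the integral over the product measure
  factors by Fubini.\<close>

lemma gauss_integral_prod:
  fixes \<xi> :: "'a::euclidean_space"
  assumes b: "0 < Re b"
  shows "integrable lborel (\<lambda>x::'a. exp (- b * of_real ((norm x)\<^sup>2) + \<i> * of_real (x \<bullet> \<xi>)))" (is ?int)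
    and "(LINT x::'a|lborel. exp (- b * of_real ((norm x)\<^sup>2) + \<i> * of_real (x \<bullet> \<xi>))) = (\<Prod>i\<in>Basis. gauss1 b (\<xi> \<bullet> i))" (is ?eq)
proof -
  interpret product_sigma_finite "\<lambda>_::'a. lborel :: real measure" by standard
  define g where "g i x = exp (- b * of_real (x\<^sup>2) + \<i> * of_real ((\<xi> \<bullet> i) * x))" for i :: 'a and x :: real
  define T where "T f = (\<Sum>i\<in>Basis. f i *\<^sub>R i)" for f :: "'a \<Rightarrow> real"
  have T[measurable]: "T \<in> measurable (Pi\<^sub>M Basis (\<lambda>_. lborel)) borel"
    unfolding T_def by measurable
  have int: "integrable lborel (g i)" for i unfolding g_def by (rule integrable_gauss1[OF b])
  define F where "F x = exp (- b * of_real ((norm x)\<^sup>2) + \<i> * of_real (x \<bullet> \<xi>))" for x :: 'a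
  have F[measurable]: "F \<in> borel_measurable borel"
    unfolding F_def by (intro borel_measurable_continuous_onI continuous_intros)
  have *: "F (T f) = (\<Prod>i\<in>Basis. g i (f i))" for f
  proof -
    have c: "T f \<bullet> i = f i" if "i \<in> Basis" for i using that by (simp add: T_def)
    have "(norm (T f))\<^sup>2 = (\<Sum>i\<in>Basis. (f i)\<^sup>2)"
      unfolding power2_norm_eq_inner euclidean_inner[of "T f" "T f"] by (simp add: c power2_eq_square)
    moreover have "T f \<bullet> \<xi> = (\<Sum>i\<in>Basis. (\<xi> \<bullet> i) * f i)"
      unfolding euclidean_inner[of "T f" \<xi>] by (simp add: c mult.commute)
    ultimately show ?thesis
      by (simp add: F_def g_def exp_sum[symmetric] sum_distrib_left sum.distrib sum_negf sum_subtractf)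
  qed
  show ?int
    unfolding F_def[symmetric]
    by (subst lborel_eq, subst integrable_distr_eq) 
       (use product_integrable_prod[OF finite_Basis int] * T F in \<open>auto simp: T_def[symmetric]\<close>)
  have "(LINT x|lborel. F x) = (LINT f|Pi\<^sub>M Basis (\<lambda>_. lborel). F (T f))"
    by (subst lborel_eq, subst integral_distr) (use T F in \<open>auto simp: T_def[symmetric]\<close>)
  also have "\<dots> = (\<Prod>i\<in>Basis. gauss1 b (\<xi> \<bullet> i))"
    unfolding * by (subst product_integral_prod[OF finite_Basis int]) (simp add: gauss1_def g_def[abs_def])
  finally show ?eq unfolding F_def .
qed

text \<open>In dimension two the factors sqrt(pi/b) multiply to pi/b, so both sides are holomorphic
  on Re b > 0 without a choice of branch. They agree for positive real b, and the identity theorem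
  extends this.\<close>

lemma gauss_integral_plane:
  fixes \<xi> :: "real^2"
  assumes b: "0 < Re b"
  shows "(LINT x::real^2|lborel. exp (- b * of_real ((norm x)\<^sup>2) + \<i> * of_real (x \<bullet> \<xi>))) =
         of_real pi / b * exp (- of_real ((norm \<xi>)\<^sup>2) / (4 * b))"
proof -
  define f where "f b = (\<Prod>i\<in>Basis. gauss1 b (\<xi> \<bullet> i)) - of_real pi / b * exp (- of_real ((norm \<xi>)\<^sup>2) / (4 * b))" for b
  let ?H = "{b. 0 < Re b}"
  have "f holomorphic_on ?H"
    unfolding f_def
    by (intro holomorphic_on_diff holomorphic_on_prod gauss1_holomorphic holomorphic_intros) auto
  moreover have "1 islimpt complex_of_real ` {0<..}"
    unfolding islimpt_approachable
  proof (intro allI impI bexI conjI)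
    fix e :: real assume "e > 0"
    then show "complex_of_real (1 + e / 2) \<in> complex_of_real ` {0<..}" by (intro imageI) simp
    show "complex_of_real (1 + e / 2) \<noteq> 1" "dist (complex_of_real (1 + e / 2)) 1 < e"
      using \<open>e > 0\<close> by (simp_all add: dist_norm)
  qed
  moreover have "f (of_real r) = 0" if r: "r > 0" for r
  proof -
    have "(\<Prod>i\<in>Basis. gauss1 (of_real r) (\<xi> \<bullet> i)) =
        of_real (\<Prod>i\<in>(Basis :: (real^2) set). sqrt (pi / r) * exp (- (\<xi> \<bullet> i)\<^sup>2 / (4 * r)))"
      by (simp add: gauss1_of_real[OF r])
    also have "(\<Prod>i\<in>(Basis :: (real^2) set). sqrt (pi / r) * exp (- (\<xi> \<bullet> i)\<^sup>2 / (4 * r))) =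
        (sqrt (pi / r))\<^sup>2 * exp (\<Sum>i\<in>Basis. - (\<xi> \<bullet> i)\<^sup>2 / (4 * r))"
      by (simp add: prod.distrib exp_sum)
    also have "(\<Sum>i\<in>Basis. - (\<xi> \<bullet> i)\<^sup>2 / (4 * r)) = - (norm \<xi>)\<^sup>2 / (4 * r)"
      unfolding sum_divide_distrib[symmetric] sum_negf power2_norm_eq_inner euclidean_inner[of \<xi> \<xi>]
      by (simp add: power2_eq_square)
    also have "(sqrt (pi / r))\<^sup>2 = pi / r" using r by simp
    finally show ?thesis by (simp add: f_def exp_of_real[symmetric])
  qed
  ultimately have "f b = 0"
    by (intro analytic_continuation[of f ?H "complex_of_real ` {0<..}" 1 b])
       (use b in \<open>auto intro: open_halfspace_Re_gt convex_connected convex_halfspace_Re_gt\<close>)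
  then show ?thesis unfolding gauss_integral_prod(2)[OF b] by (simp add: f_def)
qed

section \<open>Radial Schwartz functions from their profiles\<close>

text \<open>\<open>H j\<close> is the j-th derivative of the profile \<open>H 0\<close>. Decay is
  asked on u >= 0, since u stands for |x|^2.\<close>

definition rapid_profile :: "(nat \<Rightarrow> real \<Rightarrow> complex) \<Rightarrow> bool" where
  "rapid_profile H \<longleftrightarrow>
     (\<forall>j u. (H j has_vector_derivative H (Suc j) u) (at u)) \<and>
     (\<forall>j k. \<exists>B. \<forall>u\<ge>0. u ^ k * norm (H j u) \<le> B)"

text \<open>A class containing x -> H 0 (|x|^2) that is closed under partial derivatives: the chain
  rule produces only coordinate factors and higher \<open>H j\<close>.\<close>

inductive_set profile_span :: "(nat \<Rightarrow> real \<Rightarrow> complex) \<Rightarrow> ('a::euclidean_space \<Rightarrow> complex) set"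
  for H where
  base: "(\<lambda>x. H j ((norm x)\<^sup>2)) \<in> profile_span H"
| coord: "f \<in> profile_span H \<Longrightarrow> (\<lambda>x. of_real (x \<bullet> b) * f x) \<in> profile_span H"
| cmult: "f \<in> profile_span H \<Longrightarrow> (\<lambda>x. c * f x) \<in> profile_span H"
| add: "f \<in> profile_span H \<Longrightarrow> g \<in> profile_span H \<Longrightarrow> (\<lambda>x. f x + g x) \<in> profile_span H"

lemma profile_span_has_derivative:
  assumes H: "rapid_profile H" and f: "f \<in> profile_span H"
  shows "\<exists>f'. (\<forall>x. (f has_derivative f' x) (at x)) \<and> (\<forall>b. (\<lambda>x. f' x b) \<in> profile_span H)"
  using f
proof induction
  case (base j)
  define f' where "f' x h = of_real (x \<bullet> h) * (2 * H (Suc j) ((norm x)\<^sup>2))" for x h :: 'a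
  have "((\<lambda>x. H j ((norm x)\<^sup>2)) has_derivative f' x) (at x)" for x
  proof -
    have "(H j has_derivative (\<lambda>h. h *\<^sub>R H (Suc j) ((norm x)\<^sup>2))) (at ((norm x)\<^sup>2))"
      using H by (auto simp: rapid_profile_def has_vector_derivative_def)
    moreover have "((\<lambda>x. (norm x)\<^sup>2) has_derivative (\<lambda>h. 2 * (x \<bullet> h))) (at x)"
      unfolding power2_norm_eq_inner by (auto intro!: derivative_eq_intros simp: inner_commute)
    ultimately have "((\<lambda>x. H j ((norm x)\<^sup>2)) has_derivative (\<lambda>h. (2 * (x \<bullet> h)) *\<^sub>R H (Suc j) ((norm x)\<^sup>2))) (at x)"
      by (rule has_derivative_compose[rotated])
    then show ?thesis by (simp add: f'_def[abs_def] scaleR_conv_of_real mult_ac)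
  qed
  moreover have "(\<lambda>x. f' x b) \<in> profile_span H" for b
    unfolding f'_def by (intro profile_span.intros)
  ultimately show ?case by blast
next
  case (coord f b)
  then obtain f' where f': "\<And>x. (f has_derivative f' x) (at x)" "\<And>b. (\<lambda>x. f' x b) \<in> profile_span H"
    by blast
  show ?case
  proof (intro exI conjI allI)
    fix x show "((\<lambda>x. of_real (x \<bullet> b) * f x) has_derivative (\<lambda>h. of_real (x \<bullet> b) * f' x h + of_real (h \<bullet> b) * f x)) (at x)"
      by (auto intro!: derivative_eq_intros f')
  next
    fix h show "(\<lambda>x. of_real (x \<bullet> b) * f' x h + of_real (h \<bullet> b) * f x) \<in> profile_span H"
      by (intro profile_span.intros f' coord)
  qed
next
  case (cmult f c)
  then obtain f' where f': "\<And>x. (f has_derivative f' x) (at x)" "\<And>b. (\<lambda>x. f' x b) \<in> profile_span H"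
    by blast
  then show ?case
    by (intro exI[of _ "\<lambda>x h. c * f' x h"]) (auto intro!: derivative_eq_intros profile_span.intros)
next
  case (add f g)
  then obtain f' g' where "\<And>x. (f has_derivative f' x) (at x)" "\<And>b. (\<lambda>x. f' x b) \<in> profile_span H"
      "\<And>x. (g has_derivative g' x) (at x)" "\<And>b. (\<lambda>x. g' x b) \<in> profile_span H"
    by blast
  then show ?case
    by (intro exI[of _ "\<lambda>x h. f' x h + g' x h"]) (auto intro!: derivative_eq_intros profile_span.intros)
qed

text \<open>A coordinate factor costs one power of |x|, so the induction treats all exponents
  \<open>k\<close> at once.\<close>

lemma profile_span_bounded:
  assumes H: "rapid_profile H" and f: "f \<in> profile_span H"
  shows "\<exists>B. \<forall>x. norm x ^ k * norm (f x) \<le> B"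
  using f
proof (induction arbitrary: k)
  case (base j)
  obtain B0 where B0: "\<And>u. u \<ge> 0 \<Longrightarrow> u ^ 0 * norm (H j u) \<le> B0"
    using H unfolding rapid_profile_def by blast
  obtain Bk where Bk: "\<And>u. u \<ge> 0 \<Longrightarrow> u ^ k * norm (H j u) \<le> Bk"
    using H unfolding rapid_profile_def by blast
  have "norm x ^ k * norm (H j ((norm x)\<^sup>2)) \<le> B0 + Bk" for x :: 'a
  proof -
    \<comment> \<open>An odd power of |x| is not a power of u = |x|^2; this bound reduces it to the
      powers 0 and k of u.\<close>
    have "norm x ^ k \<le> 1 + ((norm x)\<^sup>2) ^ k"
    proof (cases "norm x \<le> 1")
      case True
      then have "norm x ^ k \<le> 1" by (simp add: power_le_one)
      then show ?thesis by (smt (verit) zero_le_power zero_le_power2)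
    next
      case False
      then have "norm x \<le> (norm x)\<^sup>2"
        using self_le_power[of "norm x" 2] by simp
      then have "norm x ^ k \<le> ((norm x)\<^sup>2) ^ k" by (intro power_mono) auto
      then show ?thesis by simp
    qed
    then have "norm x ^ k * norm (H j ((norm x)\<^sup>2)) \<le> (1 + ((norm x)\<^sup>2) ^ k) * norm (H j ((norm x)\<^sup>2))"
      by (rule mult_right_mono) simp
    also have "\<dots> \<le> B0 + Bk"
      using B0[of "(norm x)\<^sup>2"] Bk[of "(norm x)\<^sup>2"] by (simp add: ring_distribs)
    finally show ?thesis .
  qed
  then show ?case by blast
next
  case (coord f b)
  obtain B where B: "\<And>x. norm x ^ Suc k * norm (f x) \<le> B" using coord.IH by blast
  have "norm x ^ k * norm (of_real (x \<bullet> b) * f x) \<le> norm b * B" for x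
  proof -
    have "norm x ^ k * norm (of_real (x \<bullet> b) * f x) \<le> norm x ^ k * ((norm x * norm b) * norm (f x))"
      unfolding norm_mult norm_of_real by (intro mult_left_mono mult_right_mono Cauchy_Schwarz_ineq2) auto
    also have "\<dots> = norm b * (norm x ^ Suc k * norm (f x))" by simp
    also have "\<dots> \<le> norm b * B" by (intro mult_left_mono B) simp
    finally show ?thesis .
  qed
  then show ?case by blast
next
  case (cmult f c)
  obtain B where B: "\<And>x. norm x ^ k * norm (f x) \<le> B" using cmult.IH by blast
  have "norm x ^ k * norm (c * f x) \<le> norm c * B" for x
    using mult_left_mono[OF B[of x], of "norm c"] by (simp add: norm_mult mult_ac)
  then show ?case by blast
next
  case (add f g)
  obtain B where B: "\<And>x. norm x ^ k * norm (f x) \<le> B" using add.IH by blast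
  obtain C where C: "\<And>x. norm x ^ k * norm (g x) \<le> C" using add.IH by blast
  have "norm x ^ k * norm (f x + g x) \<le> B + C" for x
  proof -
    have "norm x ^ k * norm (f x + g x) \<le> norm x ^ k * (norm (f x) + norm (g x))"
      by (intro mult_left_mono norm_triangle_ineq) auto
    then show ?thesis using B[of x] C[of x] by (simp add: ring_distribs)
  qed
  then show ?case by blast
qed

lemma profile_span_iter_partial:
  assumes H: "rapid_profile H" and f: "f \<in> profile_span H"
  shows "iter_partial bs f \<in> profile_span H"
proof (induction bs)
  case (Cons b bs)
  obtain f' where f': "\<And>x. (iter_partial bs f has_derivative f' x) (at x)" "\<And>b. (\<lambda>x. f' x b) \<in> profile_span H"
    using profile_span_has_derivative[OF H Cons.IH] by blast
  have "frechet_derivative (iter_partial bs f) (at x) = f' x" for x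
    using frechet_derivative_at[OF f'(1)] by simp
  then show ?case using f'(2) by simp
qed (use f in simp)

lemma schwartz_radial_profile:
  assumes "rapid_profile H"
  shows "schwartz (\<lambda>x. H 0 ((norm x)\<^sup>2))"
  unfolding schwartz_def
proof (intro allI impI conjI)
  fix bs :: "'a list" and x :: 'a and k :: nat
  have *: "iter_partial bs (\<lambda>x. H 0 ((norm x)\<^sup>2)) \<in> profile_span H"
    by (intro profile_span_iter_partial assms profile_span.intros)
  show "iter_partial bs (\<lambda>x. H 0 ((norm x)\<^sup>2)) differentiable (at x)"
    using profile_span_has_derivative[OF assms *] by (auto simp: differentiable_def)
  obtain B where "\<And>x. norm x ^ k * norm (iter_partial bs (\<lambda>x. H 0 ((norm x)\<^sup>2)) x) \<le> B"
    using profile_span_bounded[OF assms *] by blast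
  then show "bounded (range (\<lambda>x. norm x ^ k * norm (iter_partial bs (\<lambda>x. H 0 ((norm x)\<^sup>2)) x)))"
    by (intro boundedI[of _ B]) auto
qed

section \<open>Superpositions of Gaussians\<close>

text \<open>The j-th derivative in u of the superposition of the Gaussians e^(i pi tau u) along the
  curve \<open>\<tau>\<close> with density \<open>c\<close>.\<close>

definition gsup :: "(real \<Rightarrow> complex) \<Rightarrow> (real \<Rightarrow> complex) \<Rightarrow> nat \<Rightarrow> real \<Rightarrow> complex" where
  "gsup c \<tau> j u = integral {0..1} (\<lambda>\<theta>. c \<theta> * (\<i> * of_real pi * \<tau> \<theta>) ^ j * exp (\<i> * of_real pi * \<tau> \<theta> * of_real u))"

lemma gsup_has_vector_derivative:
  assumes c: "continuous_on {0..1} c" and t: "continuous_on {0..1} \<tau>"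
  shows "(gsup c \<tau> j has_vector_derivative gsup c \<tau> (Suc j) u) (at u)"
proof -
  let ?f = "\<lambda>j u \<theta>. c \<theta> * (\<i> * of_real pi * \<tau> \<theta>) ^ j * exp (\<i> * of_real pi * \<tau> \<theta> * of_real u)"
  have "((\<lambda>u. integral (cbox 0 1) (?f j u)) has_vector_derivative integral (cbox 0 1) (?f (Suc j) u)) (at u within UNIV)"
  proof (rule leibniz_rule_vector_derivative)
    fix u \<theta> :: real
    show "((\<lambda>u. ?f j u \<theta>) has_vector_derivative ?f (Suc j) u \<theta>) (at u within UNIV)"
      by (rule has_vector_derivative_real_field) (auto intro!: derivative_eq_intros)
    show "?f j u integrable_on cbox 0 1"
      by (rule integrable_continuous) (use c t in \<open>auto intro!: continuous_intros\<close>)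
    have "continuous_on (UNIV \<times> {0..1}) (\<lambda>x::real \<times> real. c (snd x))" "continuous_on (UNIV \<times> {0..1}) (\<lambda>x::real \<times> real. \<tau> (snd x))"
      by (auto intro!: continuous_on_compose2[OF c] continuous_on_compose2[OF t] continuous_intros)
    then show "continuous_on (UNIV \<times> cbox 0 1) (\<lambda>(u, \<theta>). ?f (Suc j) u \<theta>)"
      unfolding case_prod_unfold by (auto intro!: continuous_intros)
  qed auto
  then show ?thesis unfolding gsup_def[abs_def] by simp
qed

lemma continuous_bounded_norm:
  fixes f :: "real \<Rightarrow> complex"
  assumes "continuous_on {0..1} f"
  obtains B where "B > 0" "\<And>x. x \<in> {0..1} \<Longrightarrow> norm (f x) \<le> B"
proof -
  have "bounded (f ` {0..1})"
    by (intro compact_imp_bounded compact_continuous_image assms compact_Icc)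
  then show ?thesis unfolding bounded_pos using that by auto
qed

lemma gsup_bound:
  assumes c: "continuous_on {0..1} c" and t: "continuous_on {0..1} \<tau>"
    and B: "\<And>\<theta>. \<theta> \<in> {0..1} \<Longrightarrow> norm (c \<theta>) \<le> B"
    and L: "\<And>\<theta>. \<theta> \<in> {0..1} \<Longrightarrow> norm (\<tau> \<theta>) \<le> L"
    and h: "\<And>\<theta>. \<theta> \<in> {0..1} \<Longrightarrow> \<eta> \<le> Im (\<tau> \<theta>)"
    and u: "0 \<le> u"
  shows "norm (gsup c \<tau> j u) \<le> B * (pi * L) ^ j * exp (- pi * \<eta> * u)"
proof -
  have B0: "0 \<le> B" and L0: "0 \<le> L"
    by (rule order_trans[OF norm_ge_zero B[of 0]], simp, rule order_trans[OF norm_ge_zero L[of 0]], simp)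
  have "norm (gsup c \<tau> j u) \<le> integral {0..1} (\<lambda>\<theta>::real. B * (pi * L) ^ j * exp (- pi * \<eta> * u))"
    unfolding gsup_def
  proof (rule Henstock_Kurzweil_Integration.integral_norm_bound_integral)
    show "(\<lambda>\<theta>. c \<theta> * (\<i> * of_real pi * \<tau> \<theta>) ^ j * exp (\<i> * of_real pi * \<tau> \<theta> * of_real u)) integrable_on {0..1}"
      by (rule integrable_continuous_interval) (use c t in \<open>auto intro!: continuous_intros\<close>)
    fix \<theta> :: real assume \<theta>: "\<theta> \<in> {0..1}"
    have "norm (exp (\<i> * of_real pi * \<tau> \<theta> * of_real u)) = exp (- pi * Im (\<tau> \<theta>) * u)"
      by (simp add: norm_exp_eq_Re)
    also have "\<dots> \<le> exp (- pi * \<eta> * u)"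
      using mult_right_mono[OF h[OF \<theta>] u] by (simp add: mult_left_mono mult.assoc)
    finally have 1: "norm (exp (\<i> * of_real pi * \<tau> \<theta> * of_real u)) \<le> exp (- pi * \<eta> * u)" .
    have 2: "norm ((\<i> * of_real pi * \<tau> \<theta>) ^ j) \<le> (pi * L) ^ j"
      unfolding norm_power by (rule power_mono) (use L[OF \<theta>] in \<open>auto simp: norm_mult\<close>)
    show "norm (c \<theta> * (\<i> * of_real pi * \<tau> \<theta>) ^ j * exp (\<i> * of_real pi * \<tau> \<theta> * of_real u)) \<le> B * (pi * L) ^ j * exp (- pi * \<eta> * u)"
      unfolding norm_mult[of "_ * _ ^ _"] norm_mult[of "c \<theta>"] 
      by (intro mult_mono B[OF \<theta>] 1 2) (use B0 L0 in auto)
  qed auto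
  then show ?thesis by simp
qed

text \<open>From y <= e^y at y = a u / k, raised to the k-th power.\<close>

lemma power_exp_bounded:
  assumes "0 < a" "0 \<le> u"
  shows "u ^ k * exp (- a * u) \<le> (real k / a) ^ k"
proof (cases "k = 0")
  case False
  have "a * u / real k \<le> exp (a * u / real k)"
    using exp_ge_add_one_self[of "a * u / real k"] by linarith
  then have "u / (real k / a) \<le> exp (a * u / real k)"
    by (simp add: mult.commute)
  then have "(u / (real k / a)) ^ k \<le> exp (a * u / real k) ^ k"
    using assms by (intro power_mono) auto
  also have "\<dots> = exp (a * u)"
    using False by (simp add: exp_of_nat_mult[symmetric])
  finally have "u ^ k \<le> (real k / a) ^ k * exp (a * u)"
    using assms False by (simp add: power_divide field_simps)
  then show ?thesis by (simp add: exp_minus field_simps)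
qed (use assms in simp)

lemma compact_Im_lower:
  assumes t: "continuous_on {0..1::real} \<tau>" and pos: "\<And>\<theta>. \<theta> \<in> {0..1} \<Longrightarrow> 0 < Im (\<tau> \<theta>)"
  obtains \<eta> where "0 < \<eta>" "\<And>\<theta>. \<theta> \<in> {0..1} \<Longrightarrow> \<eta> \<le> Im (\<tau> \<theta>)"
proof -
  have "continuous_on {0..1} (\<lambda>\<theta>. Im (\<tau> \<theta>))" using t by (intro continuous_intros)
  then obtain x where x: "x \<in> {0..1}" "\<forall>y\<in>{0..1}. Im (\<tau> x) \<le> Im (\<tau> y)"
    using continuous_attains_inf[OF compact_Icc, of 0 1 "\<lambda>\<theta>. Im (\<tau> \<theta>)"] by auto
  show ?thesis by (rule that[of "Im (\<tau> x)"]) (use x pos in auto)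
qed

text \<open>By compactness the curve stays above some height eta > 0, so every derivative decays
  exponentially.\<close>

lemma rapid_profile_gsup:
  assumes c: "continuous_on {0..1} c" and t: "continuous_on {0..1} \<tau>"
    and pos: "\<And>\<theta>. \<theta> \<in> {0..1} \<Longrightarrow> 0 < Im (\<tau> \<theta>)"
  shows "rapid_profile (gsup c \<tau>)"
  unfolding rapid_profile_def
proof (intro conjI allI)
  fix j k :: nat
  obtain \<eta> where \<eta>: "0 < \<eta>" "\<And>\<theta>. \<theta> \<in> {0..1} \<Longrightarrow> \<eta> \<le> Im (\<tau> \<theta>)"
    using compact_Im_lower[OF t pos] by blast
  obtain B where B: "B > 0" "\<And>\<theta>. \<theta> \<in> {0..1} \<Longrightarrow> norm (c \<theta>) \<le> B" 
    using continuous_bounded_norm[OF c] by blast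
  obtain L where L: "L > 0" "\<And>\<theta>. \<theta> \<in> {0..1} \<Longrightarrow> norm (\<tau> \<theta>) \<le> L" 
    using continuous_bounded_norm[OF t] by blast
  have "u ^ k * norm (gsup c \<tau> j u) \<le> B * (pi * L) ^ j * (real k / (pi * \<eta>)) ^ k" if u: "u \<ge> 0" for u
  proof -
    have "u ^ k * norm (gsup c \<tau> j u) \<le> u ^ k * (B * (pi * L) ^ j * exp (- pi * \<eta> * u))"
      by (intro mult_left_mono gsup_bound c t B(2) L(2) \<eta>(2) u) (use u in auto)
    also have "\<dots> = B * (pi * L) ^ j * (u ^ k * exp (- (pi * \<eta>) * u))" by simp
    also have "\<dots> \<le> B * (pi * L) ^ j * (real k / (pi * \<eta>)) ^ k"
      by (intro mult_left_mono power_exp_bounded u) (use \<eta>(1) B(1) L(1) in auto)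
    finally show ?thesis .
  qed
  then show "\<exists>B. \<forall>u\<ge>0. u ^ k * norm (gsup c \<tau> j u) \<le> B" by blast
qed (rule gsup_has_vector_derivative[OF c t])

text \<open>Fubini, and then the plane Gaussian integral at b = -i pi tau: the transform of e^(i pi
  tau |x|^2) is (i/tau) e^(i pi (-1/tau) |xi|^2).\<close>

lemma fourier_gsup:
  fixes \<xi> :: "real^2"
  assumes c: "continuous_on {0..1} c" and t: "continuous_on {0..1} \<tau>"
    and pos: "\<And>\<theta>. \<theta> \<in> {0..1} \<Longrightarrow> 0 < Im (\<tau> \<theta>)"
  shows "integrable lborel (\<lambda>x. gsup c \<tau> 0 ((norm x)\<^sup>2) * exp (2 * complex_of_real pi * \<i> * complex_of_real (x \<bullet> \<xi>)))"
      (is ?int)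
    and "fourier (\<lambda>x. gsup c \<tau> 0 ((norm x)\<^sup>2)) \<xi> = gsup (\<lambda>\<theta>. c \<theta> * (\<i> / \<tau> \<theta>)) (\<lambda>\<theta>. - 1 / \<tau> \<theta>) 0 ((norm \<xi>)\<^sup>2)"
      (is ?eq)
proof -
  define F where "F x \<theta> = c \<theta> * exp (\<i> * of_real pi * \<tau> \<theta> * of_real ((norm x)\<^sup>2)) * exp (2 * complex_of_real pi * \<i> * complex_of_real (x \<bullet> \<xi>))"
    for x :: "real^2" and \<theta> :: real
  \<comment> \<open>The indicator extends the integrand by zero, so that Fubini applies to a product
    of two Lebesgue measures.\<close>
  define G where "G x \<theta> = indicator {0..1} \<theta> *\<^sub>R F x \<theta>" for x \<theta>
  obtain \<eta> where \<eta>: "0 < \<eta>" "\<And>\<theta>. \<theta> \<in> {0..1} \<Longrightarrow> \<eta> \<le> Im (\<tau> \<theta>)"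
    using compact_Im_lower[OF t pos] by blast
  obtain B where B: "B > 0" "\<And>\<theta>. \<theta> \<in> {0..1} \<Longrightarrow> norm (c \<theta>) \<le> B" 
    using continuous_bounded_norm[OF c] by blast
  have contF: "continuous_on {0..1} (F x)" for x
    unfolding F_def using c t by (auto intro!: continuous_intros)
  have intF: "set_integrable lborel {0..1} (F x)" for x
    by (intro borel_integrable_atLeastAtMost' contF)
  have G_int: "integrable lborel (G x)" for x
    using intF unfolding G_def[abs_def] set_integrable_def .
  have inner: "(LINT \<theta>|lborel. G x \<theta>) = gsup c \<tau> 0 ((norm x)\<^sup>2) * exp (2 * complex_of_real pi * \<i> * complex_of_real (x \<bullet> \<xi>))" for x
  proof -
    have "(LINT \<theta>|lborel. G x \<theta>) = integral {0..1} (F x)"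
      using set_borel_integral_eq_integral(2)[OF intF] unfolding G_def set_lebesgue_integral_def .
    then show ?thesis unfolding F_def gsup_def by simp
  qed
  \<comment> \<open>The integrable majorant for Fubini, independent of theta.\<close>
  have normF: "norm (F x \<theta>) \<le> B * exp (- (pi * \<eta>) * (norm x)\<^sup>2)" if "\<theta> \<in> {0..1}" for x \<theta>
  proof -
    have "norm (F x \<theta>) = norm (c \<theta>) * exp (- pi * Im (\<tau> \<theta>) * (norm x)\<^sup>2)"
      by (simp add: F_def norm_mult norm_exp_eq_Re)
    also have "\<dots> \<le> B * exp (- (pi * \<eta>) * (norm x)\<^sup>2)"
      by (intro mult_mono B(2) that) (use \<eta>(2)[OF that] B(1) in \<open>auto intro!: mult_right_mono mult_left_mono\<close>)
    finally show ?thesis .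
  qed
  have meas: "case_prod G \<in> borel_measurable (lborel \<Otimes>\<^sub>M lborel)"
  proof -
    have "continuous_on (UNIV \<times> {0..1}) (\<lambda>x::(real^2) \<times> real. c (snd x))" "continuous_on (UNIV \<times> {0..1}) (\<lambda>x::(real^2) \<times> real. \<tau> (snd x))"
      by (auto intro!: continuous_on_compose2[OF c] continuous_on_compose2[OF t] continuous_intros)
    then have "continuous_on (UNIV \<times> {0..1}) (\<lambda>p. F (fst p) (snd p))"
      unfolding F_def by (auto intro!: continuous_intros)
    then have "(\<lambda>p. indicator (UNIV \<times> {0..1}) p *\<^sub>R F (fst p) (snd p)) \<in> borel_measurable borel"
      by (intro borel_measurable_continuous_on_indicator) (auto intro!: borel_closed closed_Times)
    moreover have "(\<lambda>p. indicator (UNIV \<times> {0..1}) p *\<^sub>R F (fst p) (snd p)) = case_prod G"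
      by (auto simp: G_def indicator_def fun_eq_iff)
    ultimately show ?thesis
      by (simp add: lborel_prod)
  qed
  have gauss: "integrable lborel (\<lambda>x::real^2. exp (- (pi * \<eta>) * (norm x)\<^sup>2))"
    using integrable_norm[OF gauss_integral_prod(1)[of "of_real (pi * \<eta>)" "0 :: real^2"]] \<eta>(1)
    by (simp add: norm_exp_eq_Re)
  have prod_int: "integrable (lborel \<Otimes>\<^sub>M lborel) (case_prod G)"
  proof (rule lborel_pair.Fubini_integrable[OF meas])
    show "integrable lborel (\<lambda>x. LINT \<theta>|lborel. norm (case_prod G (x, \<theta>)))"
    proof (rule Bochner_Integration.integrable_bound)
      show "integrable lborel (\<lambda>x::real^2. B * exp (- (pi * \<eta>) * (norm x)\<^sup>2))"
        by (intro integrable_mult_right gauss)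
      show "(\<lambda>x. LINT \<theta>|lborel. norm (case_prod G (x, \<theta>))) \<in> borel_measurable lborel"
        using meas by measurable
      have "norm (LINT \<theta>|lborel. norm (G x \<theta>)) \<le> B * exp (- (pi * \<eta>) * (norm x)\<^sup>2)" for x
      proof -
        have const: "integrable lborel (\<lambda>\<theta>::real. indicator {0..1} \<theta> *\<^sub>R (B * exp (- (pi * \<eta>) * (norm x)\<^sup>2)))"
          unfolding set_integrable_def[symmetric] by (intro borel_integrable_atLeastAtMost' continuous_intros)
        have "(LINT \<theta>|lborel. norm (G x \<theta>)) \<le> (LINT (\<theta>::real)|lborel. indicator {0..1} \<theta> *\<^sub>R (B * exp (- (pi * \<eta>) * (norm x)\<^sup>2)))"
          by (intro Bochner_Integration.integral_mono integrable_norm G_int const) (use normF in \<open>auto simp: G_def indicator_def\<close>)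
        also have "\<dots> = B * exp (- (pi * \<eta>) * (norm x)\<^sup>2)" by simp
        finally show ?thesis by simp
      qed
      then show "AE x in lborel. norm (LINT \<theta>|lborel. norm (case_prod G (x, \<theta>))) \<le> norm (B * exp (- (pi * \<eta>) * (norm x)\<^sup>2))"
        using B(1) by simp
    qed
    show "AE x in lborel. integrable lborel (\<lambda>\<theta>. case_prod G (x, \<theta>))"
      using G_int by simp
  qed
  show ?int using lborel_pair.integrable_fst[OF prod_int] by (simp add: inner)
  have outer: "(LINT x|lborel. G x \<theta>) = indicator {0..1} \<theta> *\<^sub>R (c \<theta> * (\<i> / \<tau> \<theta>) * exp (\<i> * of_real pi * (- 1 / \<tau> \<theta>) * of_real ((norm \<xi>)\<^sup>2)))" for \<theta>
  proof (cases "\<theta> \<in> {0..1}")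
    case True
    define b where "b = - \<i> * of_real pi * \<tau> \<theta>"
    have b: "0 < Re b" using pos[OF True] by (simp add: b_def)
    have t0: "\<tau> \<theta> \<noteq> 0" using pos[OF True] by auto
    have "(LINT x|lborel. G x \<theta>) = (LINT x|lborel. c \<theta> * exp (- b * of_real ((norm x)\<^sup>2) + \<i> * of_real (x \<bullet> ((2 * pi) *\<^sub>R \<xi>))))"
      using True by (intro Bochner_Integration.integral_cong) (auto simp: G_def F_def b_def exp_add mult_ac)
    also have "\<dots> = c \<theta> * (of_real pi / b * exp (- of_real ((norm ((2 * pi) *\<^sub>R \<xi>))\<^sup>2) / (4 * b)))"
      by (simp only: integral_mult_right_zero gauss_integral_plane[OF b])
    also have "of_real pi / b = \<i> / \<tau> \<theta>"
      using t0 by (simp add: b_def field_simps)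
    also have "- of_real ((norm ((2 * pi) *\<^sub>R \<xi>))\<^sup>2) / (4 * b) = \<i> * of_real pi * (- 1 / \<tau> \<theta>) * of_real ((norm \<xi>)\<^sup>2)"
      using t0 by (simp add: b_def power_mult_distrib field_simps power2_eq_square)
    finally show ?thesis using True by (simp add: mult.assoc)
  qed (simp add: G_def)
  have "fourier (\<lambda>x. gsup c \<tau> 0 ((norm x)\<^sup>2)) \<xi> = (LINT x|lborel. LINT \<theta>|lborel. G x \<theta>)"
    unfolding fourier_def inner ..
  also have "\<dots> = (LINT \<theta>|lborel. LINT x|lborel. G x \<theta>)"
    by (rule lborel_pair.Fubini_integral[OF prod_int, symmetric])
  also have "\<dots> = gsup (\<lambda>\<theta>. c \<theta> * (\<i> / \<tau> \<theta>)) (\<lambda>\<theta>. - 1 / \<tau> \<theta>) 0 ((norm \<xi>)\<^sup>2)"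
  proof -
    have t0: "\<tau> \<theta> \<noteq> 0" if "\<theta> \<in> {0..1}" for \<theta> using pos[OF that] by auto
    have "set_integrable lborel {0..1} (\<lambda>\<theta>. c \<theta> * (\<i> / \<tau> \<theta>) * exp (\<i> * of_real pi * (- 1 / \<tau> \<theta>) * of_real ((norm \<xi>)\<^sup>2)))"
      by (intro borel_integrable_atLeastAtMost') (use c t t0 in \<open>auto intro!: continuous_intros\<close>)
    from set_borel_integral_eq_integral(2)[OF this] show ?thesis
      unfolding outer gsup_def set_lebesgue_integral_def by simp
  qed
  finally show ?eq .
qed

section \<open>Perturbing a biorthogonal system\<close>

text \<open>A fixed point of v = E_s(1) - sum_j E_j(psi_j v) solves the system, as applying phi_i
  and duality shows. The map is a contraction with constant B * suminf q < 1, so Banach's theorem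
  provides the fixed point.\<close>

lemma perturbed_biorthogonal_system:
  fixes \<phi> \<psi> :: "nat \<Rightarrow> 'v::banach \<Rightarrow> complex" and E :: "nat \<Rightarrow> complex \<Rightarrow> 'v"
  assumes phi: "\<And>i. bounded_linear (\<phi> i)" and psi: "\<And>i. linear (\<psi> i)"
    and psi_bound: "\<And>i v. norm (\<psi> i v) \<le> q i * norm v"
    and E: "\<And>i z w. E i (z - w) = E i z - E i w" and E_bound: "\<And>i z. norm (E i z) \<le> B * norm z"
    and dual: "\<And>i j z. i \<in> I \<Longrightarrow> \<phi> i (E j z) = (if i = j then z else 0)"
    and B: "0 \<le> B" and q: "summable q" and q_nonneg: "\<And>i. 0 \<le> q i" and small: "B * suminf q < 1"
  shows "\<exists>v. \<forall>i\<in>I. \<phi> i v + \<psi> i v = (if i = s then 1 else 0)"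
proof -
  define T where "T v = E s 1 - (\<Sum>j. E j (\<psi> j v))" for v
  have bd: "norm (E j (\<psi> j v)) \<le> B * q j * norm v" for j v
  proof -
    have "norm (E j (\<psi> j v)) \<le> B * norm (\<psi> j v)" by (rule E_bound)
    also have "\<dots> \<le> B * (q j * norm v)" by (intro mult_left_mono psi_bound B)
    finally show ?thesis by (simp add: mult.assoc)
  qed
  have sq: "summable (\<lambda>j. B * q j * norm v)" for v
    by (intro summable_mult summable_mult2 q)
  have sn: "summable (\<lambda>j. norm (E j (\<psi> j v)))" for v
    by (rule summable_comparison_test'[OF sq[of v], of 0]) (use bd in auto)
  have sm: "summable (\<lambda>j. E j (\<psi> j v))" for v
    by (rule summable_norm_cancel[OF sn])
  have lip: "dist (T v) (T w) \<le> (B * suminf q) * dist v w" for v w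
  proof -
    have "T v - T w = (\<Sum>j. E j (\<psi> j w)) - (\<Sum>j. E j (\<psi> j v))" by (simp add: T_def)
    also have "\<dots> = (\<Sum>j. E j (\<psi> j (w - v)))"
      by (simp add: suminf_diff[OF sm sm] E linear_diff[OF psi])
    finally have "norm (T v - T w) \<le> (\<Sum>j. norm (E j (\<psi> j (w - v))))"
      using summable_norm[OF sn] by simp
    also have "\<dots> \<le> (\<Sum>j. B * q j * norm (w - v))"
      by (rule suminf_le[OF bd sn sq])
    also have "\<dots> = (B * suminf q) * norm (w - v)"
      by (simp add: suminf_mult2[symmetric] suminf_mult summable_mult q)
    finally show ?thesis by (simp add: dist_norm norm_minus_commute)
  qed
  have "0 \<le> suminf q" using q q_nonneg by (rule suminf_nonneg)
  then obtain v where v: "T v = v"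
    using banach_fix_type[of "B * suminf q" T] small B lip by auto
  have "\<phi> i v + \<psi> i v = (if i = s then 1 else 0)" if i: "i \<in> I" for i
  proof -
    \<comment> \<open>Continuity carries phi_i through the series, and duality then keeps only the
      term j = i.\<close>
    have "\<phi> i v = \<phi> i (E s 1) - (\<Sum>j. \<phi> i (E j (\<psi> j v)))"
      using bounded_linear.suminf[OF phi sm, of i] bounded_linear.linear[OF phi[of i]]
      by (subst v[symmetric]) (simp add: T_def linear_diff)
    also have "(\<lambda>j. \<phi> i (E j (\<psi> j v))) = (\<lambda>j. if j = i then \<psi> j v else 0)"
      using dual[OF i] by auto
    also have "suminf \<dots> = \<psi> i v"
      using sums_unique[OF sums_single[of i "\<lambda>j. \<psi> j v"]] by simp
    finally show ?thesis using dual[OF i] by simp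
  qed
  then show ?thesis by blast
qed

section \<open>The Banach space of densities\<close>

text \<open>Completeness of \<open>\<Rightarrow>\<^sub>C\<close> is only available over a metric domain.\<close>

instantiation nat :: metric_space
begin

definition dist_nat :: "nat \<Rightarrow> nat \<Rightarrow> real" where
  "dist_nat m n = \<bar>real m - real n\<bar>"

definition uniformity_nat :: "(nat \<times> nat) filter" where
  "uniformity_nat = (INF e\<in>{0 <..}. principal {(x, y). dist x y < e})"

instance
proof
  fix U :: "nat set"
  \<comment> \<open>Distinct naturals are at distance at least 1, so radius 1 already yields the
    discrete topology.\<close>
  have eq: "x = y" if "\<bar>real x - real y\<bar> < 1" for x y
  proof -
    have "real x < real (Suc y)" "real y < real (Suc x)" using that by auto
    then show ?thesis unfolding of_nat_less_iff by simp
  qed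
  have "eventually (\<lambda>(x', y). x' = x \<longrightarrow> y \<in> U) uniformity" if "x \<in> U" for x
    unfolding uniformity_nat_def
    by (rule eventually_INF1[of 1]) (use that in \<open>auto simp: eventually_principal dist_nat_def dest: eq\<close>)
  then show "open U \<longleftrightarrow> (\<forall>x\<in>U. \<forall>\<^sub>F (x', y) in uniformity. x' = x \<longrightarrow> y \<in> U)"
    by (auto simp: open_discrete)
qed (auto simp: dist_nat_def uniformity_nat_def)

end

instance bcontfun :: (metric_space, banach) banach ..

text \<open>A member \<open>C\<close> stands for finitely many densities \<open>C (k, \<cdot>)\<close> on the interval \<open>[0, 1]\<close>;
  values elsewhere are irrelevant.\<close>

type_synonym dens = "(nat \<times> real) \<Rightarrow>\<^sub>C complex"

text \<open>Complex multiples; the norm structure on \<open>dens\<close> provides the real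
  ones.\<close>

definition cscale :: "complex \<Rightarrow> dens \<Rightarrow> dens" where
  "cscale z f = Bcontfun (\<lambda>x. z * f x)"

lemma apply_cscale [simp]: "apply_bcontfun (cscale z f) x = z * f x"
proof -
  have "(\<lambda>x. z * f x) \<in> bcontfun"
    by (rule bcontfun_normI[where b = "norm z * norm f"])
      (auto simp: norm_mult intro!: continuous_intros mult_left_mono norm_bounded)
  then show ?thesis by (simp add: cscale_def Bcontfun_inverse)
qed

lemma norm_cscale: "norm (cscale z f) \<le> norm z * norm f"
  by (rule norm_bound) (auto simp: norm_mult intro!: mult_left_mono norm_bounded)

text \<open>Clamping the second coordinate to [0, 1] extends each \<open>F k\<close> from the
  interval to the whole line and preserves continuity and bounds.\<close>

definition mk_dens :: "nat \<Rightarrow> (nat \<Rightarrow> real \<Rightarrow> complex) \<Rightarrow> dens" where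
  "mk_dens N F = Bcontfun (\<lambda>x. if fst x \<le> N then F (fst x) (max 0 (min 1 (snd x))) else 0)"

lemma
  assumes cont: "\<And>k. k \<le> N \<Longrightarrow> continuous_on {0..1} (F k)"
    and b: "\<And>k \<theta>. k \<le> N \<Longrightarrow> \<theta> \<in> {0..1} \<Longrightarrow> norm (F k \<theta>) \<le> b"
  shows apply_mk_dens: "\<And>k \<theta>. k \<le> N \<Longrightarrow> \<theta> \<in> {0..1} \<Longrightarrow> mk_dens N F (k, \<theta>) = F k \<theta>"
    and norm_mk_dens: "norm (mk_dens N F) \<le> b"
proof -
  let ?G = "\<lambda>x. if fst x \<le> N then F (fst x) (max 0 (min 1 (snd x))) else 0"
  have b0: "0 \<le> b" using order_trans[OF norm_ge_zero b[of 0 0]] by simp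
  have bd: "norm (?G x) \<le> b" for x using b0 by (auto intro!: b)
  have "continuous_on UNIV ?G"
    unfolding continuous_on_eq_continuous_within
  proof
    fix x :: "nat \<times> real"
    obtain k \<theta> where x: "x = (k, \<theta>)" by (cases x)
    have k: "continuous_on UNIV (\<lambda>\<theta>. if k \<le> N then F k (max 0 (min 1 \<theta>)) else 0)"
    proof (cases "k \<le> N")
      case True
      have "continuous_on UNIV (\<lambda>\<theta>. F k (max 0 (min 1 \<theta>)))"
        by (rule continuous_on_compose2[OF cont[OF True]]) (auto intro!: continuous_intros)
      then show ?thesis using True by simp
    qed simp
    have "continuous_on ({k} \<times> UNIV) (\<lambda>x. if k \<le> N then F k (max 0 (min 1 (snd x))) else 0)"
      by (rule continuous_on_compose2[OF k]) (auto intro!: continuous_intros)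
    then have "continuous_on ({k} \<times> UNIV) ?G"
      by (rule continuous_on_eq) auto
    \<comment> \<open>The naturals are discrete, so continuity can be checked on each slice
      separately.\<close>
    moreover have "open ({k} \<times> (UNIV :: real set))" by (intro open_Times open_discrete open_UNIV)
    ultimately show "continuous (at x) ?G"
      by (simp add: continuous_on_eq_continuous_at x)
  qed
  then have "?G \<in> bcontfun" using bd by (rule bcontfun_normI)
  then have app: "apply_bcontfun (mk_dens N F) x = ?G x" for x by (simp add: mk_dens_def Bcontfun_inverse)
  show "mk_dens N F (k, \<theta>) = F k \<theta>" if "k \<le> N" "\<theta> \<in> {0..1}" for k \<theta>
    using that by (simp add: app)
  show "norm (mk_dens N F) \<le> b" by (rule norm_bound) (use bd app in auto)
qed

lemma continuous_on_dens: "continuous_on S (\<lambda>\<theta>. apply_bcontfun (C :: dens) (k, \<theta>))"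
  by (rule continuous_on_compose2[OF continuous_on_apply_bcontfun[of UNIV]]) (auto intro!: continuous_intros)

text \<open>The functionals used for interpolation are built from such pairings, with norms
  controlled by sup bounds on the kernels.\<close>

definition dens_pair :: "nat \<Rightarrow> (nat \<Rightarrow> real \<Rightarrow> complex) \<Rightarrow> dens \<Rightarrow> complex" where
  "dens_pair N \<kappa> C = (\<Sum>k\<le>N. integral {0..1} (\<lambda>\<theta>. C (k, \<theta>) * \<kappa> k \<theta>))"

lemma dens_pair_integrable:
  assumes "continuous_on {0..1} (\<kappa> k)"
  shows "(\<lambda>\<theta>. apply_bcontfun (C :: dens) (k, \<theta>) * \<kappa> k \<theta>) integrable_on {0..1}"
  by (intro integrable_continuous_interval continuous_on_mult continuous_on_dens assms)

lemma dens_pair_linear: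
  assumes "\<And>k. k \<le> N \<Longrightarrow> continuous_on {0..1} (\<kappa> k)"
  shows "linear (dens_pair N \<kappa>)"
proof (rule linearI)
  show "dens_pair N \<kappa> (C + D) = dens_pair N \<kappa> C + dens_pair N \<kappa> D" for C D
    unfolding dens_pair_def sum.distrib[symmetric]
    by (rule sum.cong) (auto simp: ring_distribs assms intro!: Henstock_Kurzweil_Integration.integral_add dens_pair_integrable)
  show "dens_pair N \<kappa> (r *\<^sub>R C) = r *\<^sub>R dens_pair N \<kappa> C" for r C
    unfolding dens_pair_def by (simp add: scaleR_sum_right)
qed

lemma dens_pair_cscale: "dens_pair N \<kappa> (cscale z C) = z * dens_pair N \<kappa> C"
  unfolding dens_pair_def by (simp add: sum_distrib_left mult.assoc)

lemma norm_dens_pair: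
  assumes c: "\<And>k. k \<le> N \<Longrightarrow> continuous_on {0..1} (\<kappa> k)"
    and b: "\<And>k \<theta>. k \<le> N \<Longrightarrow> \<theta> \<in> {0..1} \<Longrightarrow> norm (\<kappa> k \<theta>) \<le> b"
  shows "norm (dens_pair N \<kappa> C) \<le> (real (Suc N) * b) * norm C"
proof -
  have "norm (integral {0..1} (\<lambda>\<theta>. C (k, \<theta>) * \<kappa> k \<theta>)) \<le> norm C * b" if k: "k \<le> N" for k
  proof -
    have "norm (integral {0..1} (\<lambda>\<theta>. C (k, \<theta>) * \<kappa> k \<theta>)) \<le> integral {0..1} (\<lambda>\<theta>::real. norm C * b)"
      by (intro Henstock_Kurzweil_Integration.integral_norm_bound_integral dens_pair_integrable c k)
        (auto simp: norm_mult intro!: mult_mono norm_bounded b k)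
    then show ?thesis by simp
  qed
  then have "norm (dens_pair N \<kappa> C) \<le> (\<Sum>k\<le>N. norm C * b)"
    unfolding dens_pair_def by (intro sum_norm_le) auto
  then show ?thesis by (simp add: mult_ac)
qed

lemma dens_pair_bounded_linear:
  assumes c: "\<And>k. k \<le> N \<Longrightarrow> continuous_on {0..1} (\<kappa> k)"
  shows "bounded_linear (dens_pair N \<kappa>)"
proof -
  have "\<exists>b. \<forall>\<theta>\<in>{0..1}. norm (\<kappa> k \<theta>) \<le> b" if "k \<le> N" for k
    using compact_imp_bounded[OF compact_continuous_image[OF c[OF that] compact_Icc]]
    by (auto simp: bounded_iff)
  then obtain b where b: "\<And>k \<theta>. k \<le> N \<Longrightarrow> \<theta> \<in> {0..1} \<Longrightarrow> norm (\<kappa> k \<theta>) \<le> b k" by metis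
  have "norm (\<kappa> k \<theta>) \<le> (\<Sum>k\<le>N. \<bar>b k\<bar>)" if "k \<le> N" "\<theta> \<in> {0..1}" for k \<theta>
  proof -
    have "\<bar>b k\<bar> \<le> (\<Sum>k\<le>N. \<bar>b k\<bar>)" by (rule member_le_sum) (use that in auto)
    then show ?thesis using b[OF that] by linarith
  qed
  then have "norm (dens_pair N \<kappa> C) \<le> norm C * (real (Suc N) * (\<Sum>k\<le>N. \<bar>b k\<bar>))" for C
    using norm_dens_pair[of N \<kappa> "\<Sum>k\<le>N. \<bar>b k\<bar>" C] c by (simp only: mult.commute[of "norm C"])
  then show ?thesis
    using dens_pair_linear[OF c] by (intro bounded_linear_intro[where K = "real (Suc N) * (\<Sum>k\<le>N. \<bar>b k\<bar>)"])
      (auto simp: linear_add linear_scale)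
qed

section \<open>A biorthogonal system of Hermite interpolation kernels\<close>

text \<open>In u this is the j-th derivative of a sum of Gaussian superpositions; in the density it
  is a linear functional. The weight \<open>a\<close> is 1 for a function and i/tau for its Fourier
  transform.\<close>

definition gdens :: "nat \<Rightarrow> (nat \<Rightarrow> real \<Rightarrow> complex) \<Rightarrow> (nat \<Rightarrow> real \<Rightarrow> complex) \<Rightarrow> nat \<Rightarrow> real \<Rightarrow> dens \<Rightarrow> complex" where
  "gdens N a \<tau> j u = dens_pair N (\<lambda>k \<theta>. a k \<theta> * (\<i> * of_real pi * \<tau> k \<theta>) ^ j * exp (\<i> * of_real pi * \<tau> k \<theta> * of_real u))"

lemma gdens_gsup: "gdens N a \<tau> j u C = (\<Sum>k\<le>N. gsup (\<lambda>\<theta>. C (k, \<theta>) * a k \<theta>) (\<tau> k) j u)"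
  unfolding gdens_def dens_pair_def gsup_def by (simp add: mult.assoc)

lemma gdens_has_vector_derivative:
  assumes "\<And>k. k \<le> N \<Longrightarrow> continuous_on {0..1} (a k)" "\<And>k. k \<le> N \<Longrightarrow> continuous_on {0..1} (\<tau> k)"
  shows "((\<lambda>u. gdens N a \<tau> j u C) has_vector_derivative gdens N a \<tau> (Suc j) u C) (at u)"
  unfolding gdens_gsup
  by (intro has_vector_derivative_sum gsup_has_vector_derivative continuous_on_mult continuous_on_dens assms) auto

lemma gdens_bounded_linear:
  assumes "\<And>k. k \<le> N \<Longrightarrow> continuous_on {0..1} (a k)" "\<And>k. k \<le> N \<Longrightarrow> continuous_on {0..1} (\<tau> k)"
  shows "bounded_linear (gdens N a \<tau> j u)"
  unfolding gdens_def by (rule dens_pair_bounded_linear) (intro continuous_intros assms; simp)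

lemma gdens_cscale: "gdens N a \<tau> j u (cscale z C) = z * gdens N a \<tau> j u C"
  unfolding gdens_def by (rule dens_pair_cscale)

section \<open>The trigonometric polynomial with double zeros at the admissible nodes\<close>

definition node :: "nat \<Rightarrow> real" where "node n = 2 * real n / sqrt 3"

text \<open>Since freq k * node n = 2 n (k - 5) / 9, the function e^(i pi freq k u) takes the value
  zeta^(n (k - 5)) at \<open>node n\<close>. Centring at k = 5 keeps |freq k| <= 5 sqrt 3 / 9 < 1
  for k <= 10.\<close>

definition freq :: "nat \<Rightarrow> real" where "freq k = (real k - 5) * sqrt 3 / 9"

definition ifreq :: "nat \<Rightarrow> complex" where "ifreq k = \<i> * of_real (pi * freq k)"

text \<open>The residues modulo 9 taken by x^2 + xy + y^2; see \<open>loeschian_mod\<close>.\<close>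

definition residues9 :: "nat set" where "residues9 = {0, 1, 3, 4, 7}"

definition zeta :: complex where "zeta = cis (2 * pi / 9)"

definition root_poly :: "complex poly" where "root_poly = (\<Prod>c\<in>residues9. [:- (zeta ^ c), 1:])"

text \<open>Squaring makes every root double; degree 10 matches the eleven frequencies k <=
  10.\<close>

definition kpoly :: "complex poly" where "kpoly = root_poly * root_poly"

lemma zeta_power: "zeta ^ n = cis (2 * pi * real n / 9)"
  by (simp add: zeta_def Complex.DeMoivre mult_ac)

lemma zeta_inj: "a < 9 \<Longrightarrow> b < 9 \<Longrightarrow> zeta ^ a = zeta ^ b \<Longrightarrow> a = b"
proof -
  assume *: "a < 9" "b < 9" "zeta ^ a = zeta ^ b"
  have "inj_on (\<lambda>k. cis (2 * pi * real k / real 9)) {..<9}"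
    using Complex.bij_betw_roots_unity[of 9] by (auto simp: bij_betw_def)
  then show "a = b" using * by (auto simp: inj_on_def zeta_power)
qed

lemma zeta_mod: "zeta ^ n = zeta ^ (n mod 9)"
proof -
  have "zeta ^ 9 = 1" by (simp add: zeta_power)
  moreover have "zeta ^ n = (zeta ^ 9) ^ (n div 9) * zeta ^ (n mod 9)"
    by (simp flip: power_mult power_add)
  ultimately show ?thesis by simp
qed

lemma degree_kpoly: "degree kpoly \<le> 10"
proof -
  have "degree root_poly = (\<Sum>c\<in>residues9. degree [:- (zeta ^ c), 1:])"
    unfolding root_poly_def by (rule degree_prod_eq_sum_degree) simp
  then have "degree root_poly \<le> 5" by (simp add: residues9_def)
  then show ?thesis unfolding kpoly_def using degree_mult_le[of root_poly root_poly] by linarith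
qed

text \<open>With kpoly = (X - z)^2 r^2 at a root z, the second derivative there is 2 r(z)^2, nonzero
  because the five powers of zeta are distinct.\<close>

lemma kpoly_at_root:
  assumes "c \<in> residues9"
  shows "poly kpoly (zeta ^ c) = 0" "poly (pderiv kpoly) (zeta ^ c) = 0"
    "poly (pderiv (pderiv kpoly)) (zeta ^ c) \<noteq> 0"
proof -
  define r where "r = (\<Prod>c\<in>residues9 - {c}. [:- (zeta ^ c), 1:])"
  have fin: "finite residues9" by (simp add: residues9_def)
  have q: "root_poly = [:- (zeta ^ c), 1:] * r"
    unfolding root_poly_def r_def by (rule prod.remove[OF fin assms])
  have "poly r (zeta ^ c) \<noteq> 0"
    using assms fin by (auto simp: r_def poly_prod residues9_def dest!: zeta_inj[rotated 2])
  then show "poly kpoly (zeta ^ c) = 0" "poly (pderiv kpoly) (zeta ^ c) = 0"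
    "poly (pderiv (pderiv kpoly)) (zeta ^ c) \<noteq> 0"
    by (simp_all add: kpoly_def q pderiv_mult pderiv_add pderiv_diff pderiv_smult pderiv_pCons)
qed

text \<open>The j-th derivative of P(u) = w^(-5) kpoly(w) with w = e^(i pi u sqrt 3 / 9); at
  \<open>node n\<close> this w is zeta^n.\<close>

definition ksum :: "nat \<Rightarrow> real \<Rightarrow> complex" where
  "ksum j u = (\<Sum>k\<le>10. coeff kpoly k * ifreq k ^ j * exp (ifreq k * of_real u))"

lemma exp_ifreq_node: "exp (ifreq k * of_real (node n)) * (zeta ^ n) ^ 5 = (zeta ^ n) ^ k"
proof -
  define t where "t = 2 * pi * real n / 9"
  have "ifreq k * of_real (node n) = \<i> * of_real ((real k - 5) * t)"
    by (simp add: ifreq_def node_def freq_def t_def flip: of_real_mult of_real_divide)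
  then have "exp (ifreq k * of_real (node n)) = cis ((real k - 5) * t)"
    by (simp only: cis_conv_exp)
  moreover have "(zeta ^ n) ^ j = cis (real j * t)" for j
    unfolding zeta_power t_def by (rule Complex.DeMoivre)
  ultimately show ?thesis by (simp add: cis_mult algebra_simps)
qed

text \<open>Double roots of \<open>kpoly\<close> become double zeros of P. The factor (zeta^n)^5
  clears the negative powers of zeta^n.\<close>

lemma ksum_node:
  assumes "n mod 9 \<in> residues9"
  shows "ksum 0 (node n) = 0" "ksum 1 (node n) = 0"
    "ksum 2 (node n) * (zeta ^ n) ^ 5 = - (of_real (pi * sqrt 3 / 9) ^ 2) * (zeta ^ (n mod 9)) ^ 2 * poly (pderiv (pderiv kpoly)) (zeta ^ (n mod 9))"
proof -
  define z where "z = zeta ^ n"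
  \<comment> \<open>The operator X d/dX - 5 is differentiation in u up to the factor i pi sqrt 3 /
    9: it multiplies the k-th coefficient by k - 5.\<close>
  define e where "e = (\<lambda>p :: complex poly. pCons 0 (pderiv p) - smult 5 p)"
  have z: "z = zeta ^ (n mod 9)" unfolding z_def by (rule zeta_mod)
  have z0: "z ^ 5 \<noteq> 0" by (simp add: z_def zeta_def)
  have ce: "coeff (e p) k = (of_nat k - 5) * coeff p k" for p k
    by (cases k) (simp_all add: e_def coeff_pderiv algebra_simps)
  have cej: "coeff ((e ^^ j) p) k = (of_nat k - 5) ^ j * coeff p k" for p k j
    by (induction j) (simp_all add: ce)
  have "degree ((e ^^ j) kpoly) \<le> 10" for j
    by (rule degree_le) (use degree_kpoly in \<open>auto simp: cej coeff_eq_0\<close>)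
  then have pe: "poly ((e ^^ j) kpoly) z = (\<Sum>k\<le>10. (of_nat k - 5) ^ j * coeff kpoly k * z ^ k)" for j
    unfolding poly_altdef cej[symmetric]
    by (intro sum.mono_neutral_left) (auto simp: not_le coeff_eq_0)
  have ks: "ksum j (node n) * z ^ 5 = (\<i> * of_real (pi * sqrt 3 / 9)) ^ j * poly ((e ^^ j) kpoly) z" for j
  proof -
    have w: "ifreq k = (\<i> * of_real (pi * sqrt 3 / 9)) * (of_nat k - 5)" for k
      by (simp add: ifreq_def freq_def)
    have x: "exp (ifreq k * of_real (node n)) * z ^ 5 = z ^ k" for k
      unfolding z_def by (rule exp_ifreq_node)
    have "coeff kpoly k * ifreq k ^ j * exp (ifreq k * of_real (node n)) * z ^ 5 =
        (\<i> * of_real (pi * sqrt 3 / 9)) ^ j * ((of_nat k - 5) ^ j * coeff kpoly k * z ^ k)" for k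
    proof -
      have "coeff kpoly k * ifreq k ^ j * exp (ifreq k * of_real (node n)) * z ^ 5 =
          coeff kpoly k * ifreq k ^ j * z ^ k"
        by (simp only: mult.assoc x)
      then show ?thesis by (simp only: w power_mult_distrib mult_ac)
    qed
    note * = this
    show ?thesis unfolding ksum_def pe sum_distrib_left sum_distrib_right by (simp only: *)
  qed
  note k = kpoly_at_root[OF assms, folded z]
  \<comment> \<open>Where a polynomial and its derivative vanish, one application of
    \<open>e\<close> gives 0 and two leave z^2 times the second derivative.\<close>
  have e1: "poly (e p) z = z * poly (pderiv p) z - 5 * poly p z" for p by (simp add: e_def)
  have e2: "poly (pderiv (e p)) z = z * poly (pderiv (pderiv p)) z - 4 * poly (pderiv p) z" for p
    by (simp add: e_def pderiv_diff pderiv_pCons pderiv_smult)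
  show "ksum 0 (node n) = 0" using ks[of 0] k z0 by simp
  show "ksum 1 (node n) = 0" using ks[of 1] k z0 by (simp add: e1)
  show "ksum 2 (node n) * (zeta ^ n) ^ 5 = - (of_real (pi * sqrt 3 / 9) ^ 2) * (zeta ^ (n mod 9)) ^ 2 * poly (pderiv (pderiv kpoly)) (zeta ^ (n mod 9))"
    using ks[of 2] k unfolding z_def[symmetric] z[symmetric]
    by (simp add: e1 e2 numeral_2_eq_2 power_mult_distrib mult_ac)
qed


section \<open>Hermite kernels as superpositions of real frequencies\<close>

definition trig :: "nat \<Rightarrow> real \<Rightarrow> dens \<Rightarrow> complex" where
  "trig = gdens 10 (\<lambda>_ _. 1) (\<lambda>k \<theta>. of_real (freq k * \<theta>))"

text \<open>With \<open>P = ksum 0\<close> and \<open>P = P' = 0\<close> at \<open>a = node n\<close>, Taylor's formula gives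
  \<open>P(u)/(u - a)\<^sup>2 = \<integral> (1 - \<theta>) P''(a + \<theta>(u - a)) d\<theta>\<close> and \<open>P(u)/(u - a) = \<integral> P'(a + \<theta>(u - a)) d\<theta>\<close>
  over \<open>[0, 1]\<close>; \<open>dval n\<close> and \<open>dder n\<close> are the densities of these two superpositions.\<close>

definition dval :: "nat \<Rightarrow> dens" where
  "dval n = mk_dens 10 (\<lambda>k \<theta>. coeff kpoly k * ifreq k ^ 2 * of_real (1 - \<theta>) * exp (ifreq k * of_real ((1 - \<theta>) * node n)))"

definition dder :: "nat \<Rightarrow> dens" where
  "dder n = mk_dens 10 (\<lambda>k \<theta>. coeff kpoly k * ifreq k * exp (ifreq k * of_real ((1 - \<theta>) * node n)))"

text \<open>The factor (1 + |ifreq k|)^2 dominates both |ifreq k|^2 and |ifreq k|, so one constant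
  bounds \<open>dval\<close> and \<open>dder\<close> uniformly in the node.\<close>

definition kbound :: real where
  "kbound = (\<Sum>k\<le>10. norm (coeff kpoly k) * (1 + norm (ifreq k)) ^ 2)"

lemma norm_exp_ifreq [simp]: "norm (exp (ifreq k * of_real x)) = 1"
  by (simp add: norm_exp_eq_Re ifreq_def)

lemma trig_has_vector_derivative: "((\<lambda>u. trig j u C) has_vector_derivative trig (Suc j) u C) (at u)"
  unfolding trig_def by (rule gdens_has_vector_derivative) (auto intro!: continuous_intros)

lemma trig_bounded_linear: "bounded_linear (trig j u)"
  unfolding trig_def by (rule gdens_bounded_linear) (auto intro!: continuous_intros)

lemma trig_cscale: "trig j u (cscale z C) = z * trig j u C"
  unfolding trig_def by (rule gdens_cscale)

lemma kbound_ge: "k \<le> 10 \<Longrightarrow> norm (coeff kpoly k) * (1 + norm (ifreq k)) ^ 2 \<le> kbound"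
  unfolding kbound_def by (rule member_le_sum) auto

lemma
  shows apply_dval: "\<And>k \<theta>. k \<le> 10 \<Longrightarrow> \<theta> \<in> {0..1} \<Longrightarrow>
      dval n (k, \<theta>) = coeff kpoly k * ifreq k ^ 2 * of_real (1 - \<theta>) * exp (ifreq k * of_real ((1 - \<theta>) * node n))"
    and norm_dval: "norm (dval n) \<le> kbound"
proof -
  have b: "norm (coeff kpoly k * ifreq k ^ 2 * of_real (1 - \<theta>) * exp (ifreq k * of_real ((1 - \<theta>) * node n))) \<le> kbound"
    if "k \<le> 10" "\<theta> \<in> {0..1}" for k \<theta>
  proof -
    have "norm (coeff kpoly k * ifreq k ^ 2 * of_real (1 - \<theta>) * exp (ifreq k * of_real ((1 - \<theta>) * node n)))
        = norm (coeff kpoly k) * norm (ifreq k) ^ 2 * \<bar>1 - \<theta>\<bar>"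
      unfolding norm_mult norm_exp_ifreq norm_power norm_of_real by simp
    also have "\<dots> \<le> norm (coeff kpoly k) * (1 + norm (ifreq k)) ^ 2 * 1"
      using that by (intro mult_mono power_mono) auto
    also have "\<dots> \<le> kbound" using kbound_ge[OF that(1)] by simp
    finally show ?thesis .
  qed
  show "dval n (k, \<theta>) = coeff kpoly k * ifreq k ^ 2 * of_real (1 - \<theta>) * exp (ifreq k * of_real ((1 - \<theta>) * node n))"
    if "k \<le> 10" "\<theta> \<in> {0..1}" for k \<theta>
    unfolding dval_def by (rule apply_mk_dens[OF _ b that]) (auto intro!: continuous_intros)
  show "norm (dval n) \<le> kbound"
    unfolding dval_def by (rule norm_mk_dens[OF _ b]) (auto intro!: continuous_intros)
qed

lemma
  shows apply_dder: "\<And>k \<theta>. k \<le> 10 \<Longrightarrow> \<theta> \<in> {0..1} \<Longrightarrow>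
      dder n (k, \<theta>) = coeff kpoly k * ifreq k * exp (ifreq k * of_real ((1 - \<theta>) * node n))"
    and norm_dder: "norm (dder n) \<le> kbound"
proof -
  have b: "norm (coeff kpoly k * ifreq k * exp (ifreq k * of_real ((1 - \<theta>) * node n))) \<le> kbound"
    if "k \<le> 10" "\<theta> \<in> {0..1}" for k \<theta>
  proof -
    have "norm (ifreq k) \<le> 1 + norm (ifreq k)" by simp
    also have "\<dots> \<le> (1 + norm (ifreq k)) ^ 2" by (rule self_le_power) auto
    finally have "norm (coeff kpoly k) * norm (ifreq k) \<le> norm (coeff kpoly k) * (1 + norm (ifreq k)) ^ 2"
      by (intro mult_left_mono) auto
    then show ?thesis
      unfolding norm_mult norm_exp_ifreq using kbound_ge[OF that(1)] by simp
  qed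
  show "dder n (k, \<theta>) = coeff kpoly k * ifreq k * exp (ifreq k * of_real ((1 - \<theta>) * node n))"
    if "k \<le> 10" "\<theta> \<in> {0..1}" for k \<theta>
    unfolding dder_def by (rule apply_mk_dens[OF _ b that]) (auto intro!: continuous_intros)
  show "norm (dder n) \<le> kbound"
    unfolding dder_def by (rule norm_mk_dens[OF _ b]) (auto intro!: continuous_intros)
qed

lemma kbound_nonneg: "0 \<le> kbound"
  using order_trans[OF norm_ge_zero norm_dval] .

text \<open>Taylor's formula with integral remainder, of first and second order, for e^(w u) from a
  to b.\<close>

lemma exp_segment_integral:
  fixes w :: complex and a b :: real
  shows "((\<lambda>\<theta>. w * of_real (b - a) * (exp (w * of_real ((1 - \<theta>) * a)) * exp (w * of_real (\<theta> * b))))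
      has_integral exp (w * of_real b) - exp (w * of_real a)) {0..1}"
    and "((\<lambda>\<theta>. (w * of_real (b - a)) ^ 2 * of_real (1 - \<theta>) * (exp (w * of_real ((1 - \<theta>) * a)) * exp (w * of_real (\<theta> * b))))
      has_integral exp (w * of_real b) - exp (w * of_real a) - w * of_real (b - a) * exp (w * of_real a)) {0..1}"
proof -
  define f where "f z = exp (w * ((1 - z) * of_real a + z * of_real b))" for z :: complex
  have f: "exp (w * of_real ((1 - \<theta>) * a)) * exp (w * of_real (\<theta> * b)) = f (of_real \<theta>)" for \<theta>
    by (simp add: f_def exp_add[symmetric] ring_distribs)
  have df: "(f has_field_derivative w * of_real (b - a) * f z) (at z)" for z
    unfolding f_def by (auto intro!: derivative_eq_intros simp: algebra_simps)
  have "((\<lambda>\<theta>. w * of_real (b - a) * f (of_real \<theta>)) has_integral f (of_real 1) - f (of_real 0)) {0..1}"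
    by (rule fundamental_theorem_of_calculus, simp, rule has_vector_derivative_real_field, rule df)
  then show "((\<lambda>\<theta>. w * of_real (b - a) * (exp (w * of_real ((1 - \<theta>) * a)) * exp (w * of_real (\<theta> * b))))
      has_integral exp (w * of_real b) - exp (w * of_real a)) {0..1}"
    unfolding f by (simp add: f_def)
  \<comment> \<open>An antiderivative: differentiating the linear factor cancels the lower order
    term of the product rule.\<close>
  define g where "g z = ((1 - z) * (w * of_real (b - a)) + 1) * f z" for z :: complex
  have dg: "(g has_field_derivative (w * of_real (b - a)) ^ 2 * (1 - z) * f z) (at z)" for z
    unfolding g_def by (auto intro!: derivative_eq_intros df simp: algebra_simps power2_eq_square)
  have "((\<lambda>\<theta>. (w * of_real (b - a)) ^ 2 * (1 - of_real \<theta>) * f (of_real \<theta>)) has_integral g (of_real 1) - g (of_real 0)) {0..1}"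
    by (rule fundamental_theorem_of_calculus, simp, rule has_vector_derivative_real_field, rule dg)
  then show "((\<lambda>\<theta>. (w * of_real (b - a)) ^ 2 * of_real (1 - \<theta>) * (exp (w * of_real ((1 - \<theta>) * a)) * exp (w * of_real (\<theta> * b))))
      has_integral exp (w * of_real b) - exp (w * of_real a) - w * of_real (b - a) * exp (w * of_real a)) {0..1}"
    unfolding f by (simp add: f_def g_def algebra_simps)
qed

lemma trig_unfold:
  "trig j u C = (\<Sum>k\<le>10. integral {0..1} (\<lambda>\<theta>. C (k, \<theta>) * ((ifreq k * of_real \<theta>) ^ j * exp (ifreq k * of_real (\<theta> * u)))))"
proof -
  have *: "\<i> * complex_of_real pi * complex_of_real (freq k * \<theta>) = ifreq k * of_real \<theta>" for k \<theta>
    by (simp add: ifreq_def)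
  show ?thesis
    unfolding trig_def gdens_def dens_pair_def * by (simp only: mult_1_left of_real_mult mult.assoc)
qed

text \<open>Termwise Taylor formula; the constant \<open>ksum 0 (node n)\<close> is kept here and
  vanishes at admissible nodes.\<close>

lemma trig_dder: "of_real (u - node n) * trig 0 u (dder n) = ksum 0 u - ksum 0 (node n)"
proof -
  let ?a = "node n"
  have "of_real (u - ?a) * integral {0..1} (\<lambda>\<theta>. dder n (k, \<theta>) * ((ifreq k * of_real \<theta>) ^ 0 * exp (ifreq k * of_real (\<theta> * u)))) =
      coeff kpoly k * (exp (ifreq k * of_real u) - exp (ifreq k * of_real ?a))" if k: "k \<le> 10" for k
  proof -
    have "of_real (u - ?a) * integral {0..1} (\<lambda>\<theta>. dder n (k, \<theta>) * ((ifreq k * of_real \<theta>) ^ 0 * exp (ifreq k * of_real (\<theta> * u)))) =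
      integral {0..1} (\<lambda>\<theta>. of_real (u - ?a) * (dder n (k, \<theta>) * ((ifreq k * of_real \<theta>) ^ 0 * exp (ifreq k * of_real (\<theta> * u)))))"
      by (rule integral_mult_right[symmetric])
    also have "\<dots> = integral {0..1} (\<lambda>\<theta>. coeff kpoly k * (ifreq k * of_real (u - ?a) * (exp (ifreq k * of_real ((1 - \<theta>) * ?a)) * exp (ifreq k * of_real (\<theta> * u)))))"
      by (rule integral_cong) (simp add: apply_dder[OF k] mult_ac)
    also have "\<dots> = coeff kpoly k * (exp (ifreq k * of_real u) - exp (ifreq k * of_real ?a))"
      by (rule integral_unique, rule has_integral_mult_right, rule exp_segment_integral)
    finally show ?thesis .
  qed
  then show ?thesis
    unfolding trig_unfold ksum_def sum_subtractf[symmetric] sum_distrib_left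
    by (intro sum.cong) (auto simp: right_diff_distrib)
qed

lemma trig_dval: "of_real (u - node n) ^ 2 * trig 0 u (dval n) = ksum 0 u - ksum 0 (node n) - of_real (u - node n) * ksum 1 (node n)"
proof -
  let ?a = "node n"
  have "of_real (u - ?a) ^ 2 * integral {0..1} (\<lambda>\<theta>. dval n (k, \<theta>) * ((ifreq k * of_real \<theta>) ^ 0 * exp (ifreq k * of_real (\<theta> * u)))) =
      coeff kpoly k * (exp (ifreq k * of_real u) - exp (ifreq k * of_real ?a) - ifreq k * of_real (u - ?a) * exp (ifreq k * of_real ?a))" if k: "k \<le> 10" for k
  proof -
    have "of_real (u - ?a) ^ 2 * integral {0..1} (\<lambda>\<theta>. dval n (k, \<theta>) * ((ifreq k * of_real \<theta>) ^ 0 * exp (ifreq k * of_real (\<theta> * u)))) =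
      integral {0..1} (\<lambda>\<theta>. of_real (u - ?a) ^ 2 * (dval n (k, \<theta>) * ((ifreq k * of_real \<theta>) ^ 0 * exp (ifreq k * of_real (\<theta> * u)))))"
      by (rule integral_mult_right[symmetric])
    also have "\<dots> = integral {0..1} (\<lambda>\<theta>. coeff kpoly k * ((ifreq k * of_real (u - ?a)) ^ 2 * of_real (1 - \<theta>) * (exp (ifreq k * of_real ((1 - \<theta>) * ?a)) * exp (ifreq k * of_real (\<theta> * u)))))"
      by (rule integral_cong) (simp add: apply_dval[OF k] power_mult_distrib mult_ac)
    also have "\<dots> = coeff kpoly k * (exp (ifreq k * of_real u) - exp (ifreq k * of_real ?a) - ifreq k * of_real (u - ?a) * exp (ifreq k * of_real ?a))"
      by (rule integral_unique, rule has_integral_mult_right, rule exp_segment_integral)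
    finally show ?thesis .
  qed
  then show ?thesis
    unfolding trig_unfold ksum_def sum_subtractf[symmetric] sum_distrib_left
    by (intro sum.cong) (auto simp: right_diff_distrib mult_ac simp del: of_real_diff)
qed

lemma of_real_has_vector_derivative:
  assumes "(f has_real_derivative f') (at x within S)"
  shows "((\<lambda>x. complex_of_real (f x)) has_vector_derivative of_real f') (at x within S)"
  using assms by (intro has_vector_derivative_of_real) (simp add: has_real_derivative_iff_has_vector_derivative)

text \<open>At u = \<open>node n\<close> the two exponentials combine to one free of theta, leaving
  the integrals of 1 - theta and of theta, both 1/2.\<close>

lemma trig_diagonal:
  "trig 0 (node n) (dval n) = ksum 2 (node n) / 2" "trig 1 (node n) (dder n) = ksum 2 (node n) / 2"
proof -
  let ?a = "node n"
  have e: "exp (ifreq k * of_real ((1 - \<theta>) * ?a)) * exp (ifreq k * of_real (\<theta> * ?a)) = exp (ifreq k * of_real ?a)" for k \<theta>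
    by (simp add: exp_add[symmetric] algebra_simps)
  have i1: "((\<lambda>\<theta>. complex_of_real (1 - \<theta>)) has_integral 1 / 2) {0..1}"
  proof -
    have "((\<lambda>\<theta>. complex_of_real (1 - \<theta>)) has_integral of_real (1 - 1\<^sup>2 / 2) - of_real (0 - 0\<^sup>2 / 2)) {0..1}"
      by (rule fundamental_theorem_of_calculus, simp, rule of_real_has_vector_derivative)
        (auto intro!: derivative_eq_intros)
    then show ?thesis by simp
  qed
  have i2: "((\<lambda>\<theta>. complex_of_real \<theta>) has_integral 1 / 2) {0..1}"
  proof -
    have "((\<lambda>\<theta>. complex_of_real \<theta>) has_integral of_real (1\<^sup>2 / 2) - of_real (0\<^sup>2 / 2)) {0..1}"
      by (rule fundamental_theorem_of_calculus, simp, rule of_real_has_vector_derivative)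
        (auto intro!: derivative_eq_intros)
    then show ?thesis by simp
  qed
  have "integral {0..1} (\<lambda>\<theta>. dval n (k, \<theta>) * ((ifreq k * of_real \<theta>) ^ 0 * exp (ifreq k * of_real (\<theta> * ?a)))) =
      coeff kpoly k * ifreq k ^ 2 * exp (ifreq k * of_real ?a) / 2" if k: "k \<le> 10" for k
  proof -
    have "integral {0..1} (\<lambda>\<theta>. dval n (k, \<theta>) * ((ifreq k * of_real \<theta>) ^ 0 * exp (ifreq k * of_real (\<theta> * ?a)))) =
        integral {0..1} (\<lambda>\<theta>. coeff kpoly k * ifreq k ^ 2 * exp (ifreq k * of_real ?a) * of_real (1 - \<theta>))"
      by (rule integral_cong) (simp add: apply_dval[OF k] e del: of_real_mult of_real_diff)
    also have "\<dots> = coeff kpoly k * ifreq k ^ 2 * exp (ifreq k * of_real ?a) * (1 / 2)"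
      by (rule integral_unique, rule has_integral_mult_right, rule i1)
    finally show ?thesis by simp
  qed
  then show "trig 0 ?a (dval n) = ksum 2 ?a / 2"
    unfolding trig_unfold ksum_def sum_divide_distrib by (intro sum.cong) auto
  have "integral {0..1} (\<lambda>\<theta>. dder n (k, \<theta>) * ((ifreq k * of_real \<theta>) ^ 1 * exp (ifreq k * of_real (\<theta> * ?a)))) =
      coeff kpoly k * ifreq k ^ 2 * exp (ifreq k * of_real ?a) / 2" if k: "k \<le> 10" for k
  proof -
    have "integral {0..1} (\<lambda>\<theta>. dder n (k, \<theta>) * ((ifreq k * of_real \<theta>) ^ 1 * exp (ifreq k * of_real (\<theta> * ?a)))) =
        integral {0..1} (\<lambda>\<theta>. coeff kpoly k * ifreq k ^ 2 * exp (ifreq k * of_real ?a) * of_real \<theta>)"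
    proof (rule integral_cong)
      fix \<theta> :: real assume "\<theta> \<in> {0..1}"
      then have "dder n (k, \<theta>) * ((ifreq k * of_real \<theta>) ^ 1 * exp (ifreq k * of_real (\<theta> * ?a))) =
          coeff kpoly k * ifreq k * (ifreq k * of_real \<theta>) * (exp (ifreq k * of_real ((1 - \<theta>) * ?a)) * exp (ifreq k * of_real (\<theta> * ?a)))"
        by (simp only: apply_dder[OF k] power_one_right mult_ac)
      then show "dder n (k, \<theta>) * ((ifreq k * of_real \<theta>) ^ 1 * exp (ifreq k * of_real (\<theta> * ?a))) =
          coeff kpoly k * ifreq k ^ 2 * exp (ifreq k * of_real ?a) * of_real \<theta>"
        unfolding e by (simp only: power2_eq_square mult_ac)
    qed
    also have "\<dots> = coeff kpoly k * ifreq k ^ 2 * exp (ifreq k * of_real ?a) * (1 / 2)"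
      by (rule integral_unique, rule has_integral_mult_right, rule i2)
    finally show ?thesis by simp
  qed
  then show "trig 1 ?a (dder n) = ksum 2 ?a / 2"
    unfolding trig_unfold ksum_def sum_divide_distrib by (intro sum.cong) auto
qed

lemma ksum_has_vector_derivative: "(ksum 0 has_vector_derivative ksum 1 u) (at u)"
  unfolding ksum_def[abs_def]
  by (intro has_vector_derivative_sum, rule has_vector_derivative_real_field)
    (auto intro!: derivative_eq_intros)


lemma node_inj: "node m = node n \<Longrightarrow> m = n"
  by (simp add: node_def)

text \<open>Write P(u) = (u - a) h(u), respectively (u - a)^2 h(u), and compare values and
  derivatives at b, where P and P' vanish. The derivative of P(u)/(u - a)^2 at a itself is left open
  and is corrected in \<open>trig_dual_system\<close>.\<close>

lemma trig_at_node:
  assumes n: "n mod 9 \<in> residues9" and m: "m mod 9 \<in> residues9"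
  shows "m \<noteq> n \<Longrightarrow> trig 0 (node m) (dval n) = 0" "m \<noteq> n \<Longrightarrow> trig 1 (node m) (dval n) = 0"
    "trig 0 (node m) (dder n) = 0" "m \<noteq> n \<Longrightarrow> trig 1 (node m) (dder n) = 0"
proof -
  let ?a = "node n" and ?b = "node m"
  let ?d = "complex_of_real (?b - ?a)"
  have d: "?d \<noteq> 0" if "m \<noteq> n" using that node_inj by auto
  have "ksum 0 u = of_real (u - ?a) * trig 0 u (dder n)" for u
    using ksum_node(1)[OF n] trig_dder[of u n] by simp
  then have k0: "ksum 0 = (\<lambda>u. of_real (u - ?a) * trig 0 u (dder n))" by blast
  have "(ksum 0 has_vector_derivative (?d * trig 1 ?b (dder n) + of_real 1 * trig 0 ?b (dder n))) (at ?b)"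
    unfolding k0 One_nat_def
    by (rule has_vector_derivative_mult[OF of_real_has_vector_derivative trig_has_vector_derivative])
      (auto intro!: derivative_eq_intros)
  then have A: "?d * trig 1 ?b (dder n) + trig 0 ?b (dder n) = 0"
    using vector_derivative_unique_at[OF ksum_has_vector_derivative[of ?b]] ksum_node(2)[OF m] by auto
  have B: "?d * trig 0 ?b (dder n) = 0"
    using ksum_node(1)[OF n] ksum_node(1)[OF m] trig_dder[of ?b n] by simp
  \<comment> \<open>For m = n the factor b - a is 0 and \<open>A\<close> alone gives the claim;
    otherwise \<open>B\<close> does.\<close>
  show *: "trig 0 ?b (dder n) = 0" using A B d by (cases "m = n") auto
  show "m \<noteq> n \<Longrightarrow> trig 1 ?b (dder n) = 0" using A d * by auto
  have "ksum 0 u = of_real ((u - ?a)\<^sup>2) * trig 0 u (dval n)" for u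
    using ksum_node(1,2)[OF n] trig_dval[of u n] by simp
  then have k0': "ksum 0 = (\<lambda>u. of_real ((u - ?a)\<^sup>2) * trig 0 u (dval n))" by blast
  have "(ksum 0 has_vector_derivative (of_real ((?b - ?a)\<^sup>2) * trig 1 ?b (dval n) + of_real (2 * (?b - ?a)) * trig 0 ?b (dval n))) (at ?b)"
    unfolding k0' One_nat_def
    by (rule has_vector_derivative_mult[OF of_real_has_vector_derivative trig_has_vector_derivative])
      (auto intro!: derivative_eq_intros)
  then have A': "?d ^ 2 * trig 1 ?b (dval n) + 2 * ?d * trig 0 ?b (dval n) = 0"
    using vector_derivative_unique_at[OF ksum_has_vector_derivative[of ?b]] ksum_node(2)[OF m] by auto
  have B': "?d ^ 2 * trig 0 ?b (dval n) = 0"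
    using ksum_node(1,2)[OF n] ksum_node(1)[OF m] trig_dval[of ?b n] by simp
  show *: "trig 0 ?b (dval n) = 0" if "m \<noteq> n" using B' d[OF that] by simp
  show "trig 1 ?b (dval n) = 0" if "m \<noteq> n" using A' d[OF that] *[OF that] by simp
qed

text \<open>Up to a factor of modulus 1, \<open>ksum 2 (node n)\<close> depends only on n modulo 9,
  so the minimum over five residues is a positive bound.\<close>

lemma ksum2_lower_bound:
  obtains m where "0 < m" "\<And>n. n mod 9 \<in> residues9 \<Longrightarrow> m \<le> norm (ksum 2 (node n) / 2)"
proof -
  define f where "f c = (pi * sqrt 3 / 9) ^ 2 * norm (poly (pderiv (pderiv kpoly)) (zeta ^ c)) / 2" for c
  have z: "norm zeta = 1" by (simp add: zeta_def)
  have f: "norm (ksum 2 (node n) / 2) = f (n mod 9)" if "n mod 9 \<in> residues9" for n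
  proof -
    have "norm (ksum 2 (node n) * (zeta ^ n) ^ 5) = norm (ksum 2 (node n))"
      by (simp add: norm_mult norm_power z)
    then show ?thesis
      unfolding ksum_node(3)[OF that] by (simp add: f_def norm_mult norm_power norm_divide z power_divide power_mult_distrib)
  qed
  have ne: "finite residues9" "residues9 \<noteq> {}" by (auto simp: residues9_def)
  show ?thesis
  proof (rule that[of "Min (f ` residues9)"])
    have "0 < f c" if "c \<in> residues9" for c
      using kpoly_at_root(3)[OF that] by (simp add: f_def)
    then show "0 < Min (f ` residues9)" using ne by auto
    show "Min (f ` residues9) \<le> norm (ksum 2 (node n) / 2)" if "n mod 9 \<in> residues9" for n
      unfolding f[OF that] using ne that by (intro Min_le) auto
  qed
qed

section \<open>A uniformly bounded dual system\<close>

lemma trig_bound_uniform: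
  "norm (trig 1 (node n) C) \<le> (11 * (\<Sum>k\<le>10. norm (ifreq k))) * norm C"
proof -
  have "norm (dens_pair 10 (\<lambda>k \<theta>. (ifreq k * of_real \<theta>) ^ 1 * exp (ifreq k * of_real (\<theta> * node n))) C)
      \<le> (real (Suc 10) * (\<Sum>k\<le>10. norm (ifreq k))) * norm C"
  proof (rule norm_dens_pair)
    fix k :: nat and \<theta> :: real assume k: "k \<le> 10" and \<theta>: "\<theta> \<in> {0..1}"
    have "norm ((ifreq k * of_real \<theta>) ^ 1 * exp (ifreq k * of_real (\<theta> * node n))) = norm (ifreq k) * \<bar>\<theta>\<bar>"
      unfolding norm_mult norm_exp_ifreq by (simp add: norm_mult)
    also have "\<dots> \<le> norm (ifreq k)" using \<theta> by (simp add: mult_left_le)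
    also have "\<dots> \<le> (\<Sum>k\<le>10. norm (ifreq k))" by (rule member_le_sum) (use k in auto)
    finally show "norm ((ifreq k * of_real \<theta>) ^ 1 * exp (ifreq k * of_real (\<theta> * node n))) \<le> (\<Sum>k\<le>10. norm (ifreq k))" .
  qed (auto intro!: continuous_intros)
  then show ?thesis unfolding trig_unfold dens_pair_def by simp
qed

text \<open>Index i encodes the node i div 2 and the order i mod 2 of the derivative. The norm
  bound, uniform in i, is what the contraction argument needs.\<close>

lemma trig_dual_system:
  obtains e :: "nat \<Rightarrow> dens" and B where "0 \<le> B" "\<And>i. (i div 2) mod 9 \<in> residues9 \<Longrightarrow> norm (e i) \<le> B"
    "\<And>i j. (i div 2) mod 9 \<in> residues9 \<Longrightarrow> (j div 2) mod 9 \<in> residues9 \<Longrightarrow>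
       trig (i mod 2) (node (i div 2)) (e j) = (if i = j then 1 else 0)"
proof -
  obtain m where m: "0 < m" "\<And>n. n mod 9 \<in> residues9 \<Longrightarrow> m \<le> norm (ksum 2 (node n) / 2)"
    using ksum2_lower_bound by blast
  define al where "al n = ksum 2 (node n) / 2" for n
  \<comment> \<open>\<open>de\<close> is normalised to derivative 1 at its node. Subtracting a
    multiple of it from the normalised \<open>dval\<close> cancels the derivative there and keeps
    the value, because \<open>dder\<close> vanishes at the node.\<close>
  define de where "de n = cscale (1 / al n) (dder n)" for n
  define va where "va n = cscale (1 / al n) (dval n) - cscale (trig 1 (node n) (dval n) / al n) (de n)" for n
  define e where "e i = (if even i then va (i div 2) else de (i div 2))" for i :: nat
  define L where "L = 11 * (\<Sum>k\<le>10. norm (ifreq k))"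
  have L: "0 \<le> L" by (simp add: L_def sum_nonneg)
  have al: "norm (1 / al n) \<le> 1 / m" "al n \<noteq> 0" if "n mod 9 \<in> residues9" for n
  proof -
    have *: "m \<le> norm (al n)" using m(2)[OF that] by (simp add: al_def)
    show "al n \<noteq> 0" using * m(1) by auto
    have "norm (1 / al n) = 1 / norm (al n)" by (simp add: norm_divide)
    also have "\<dots> \<le> 1 / m" by (rule frac_le) (use * m(1) in auto)
    finally show "norm (1 / al n) \<le> 1 / m" .
  qed
  have de: "norm (de n) \<le> kbound / m" if "n mod 9 \<in> residues9" for n
  proof -
    have "norm (de n) \<le> norm (1 / al n) * norm (dder n)" unfolding de_def by (rule norm_cscale)
    also have "\<dots> \<le> (1 / m) * kbound"
      by (intro mult_mono al(1)[OF that] norm_dder) (use m(1) in auto)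
    finally show ?thesis by simp
  qed
  have va: "norm (va n) \<le> kbound / m + L * kbound / m * (kbound / m)" if "n mod 9 \<in> residues9" for n
  proof -
    have "norm (cscale (1 / al n) (dval n)) \<le> norm (1 / al n) * norm (dval n)" by (rule norm_cscale)
    also have "\<dots> \<le> (1 / m) * kbound"
      by (intro mult_mono al(1)[OF that] norm_dval) (use m(1) in auto)
    finally have 1: "norm (cscale (1 / al n) (dval n)) \<le> kbound / m" by simp
    have "norm (trig 1 (node n) (dval n)) \<le> L * norm (dval n)" unfolding L_def by (rule trig_bound_uniform)
    also have "\<dots> \<le> L * kbound" by (intro mult_left_mono norm_dval L)
    finally have "norm (trig 1 (node n) (dval n)) * norm (1 / al n) \<le> L * kbound * (1 / m)"
      by (intro mult_mono al(1)[OF that]) (use L kbound_nonneg in auto)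
    then have t: "norm (trig 1 (node n) (dval n) / al n) \<le> L * kbound / m" by (simp add: norm_divide)
    have "norm (cscale (trig 1 (node n) (dval n) / al n) (de n)) \<le> norm (trig 1 (node n) (dval n) / al n) * norm (de n)"
      by (rule norm_cscale)
    also have "\<dots> \<le> L * kbound / m * (kbound / m)"
      by (intro mult_mono t de[OF that]) (use L kbound_nonneg m(1) in auto)
    finally show ?thesis
      unfolding va_def using 1 norm_triangle_ineq4[of "cscale (1 / al n) (dval n)" "cscale (trig 1 (node n) (dval n) / al n) (de n)"]
      by linarith
  qed
  note lin = linear_diff[OF bounded_linear.linear[OF trig_bounded_linear]]
  have cross: "trig 0 (node p) (va q) = (if p = q then 1 else 0)" "trig 1 (node p) (va q) = 0"
      "trig 0 (node p) (de q) = 0" "trig 1 (node p) (de q) = (if p = q then 1 else 0)"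
    if p: "p mod 9 \<in> residues9" and q: "q mod 9 \<in> residues9" for p q
  proof -
    note facts = trig_at_node[OF q p] trig_diagonal[of q, folded al_def] al(2)[OF q]
    show "trig 0 (node p) (va q) = (if p = q then 1 else 0)"
      using facts by (simp add: va_def de_def lin trig_cscale)
    show "trig 1 (node p) (va q) = 0"
    proof (cases "p = q")
      case True
      then show ?thesis using facts by (simp add: va_def de_def lin trig_cscale)
    next
      case False
      then show ?thesis using facts(2,4) by (simp add: va_def de_def lin trig_cscale)
    qed
    show "trig 0 (node p) (de q) = 0" "trig 1 (node p) (de q) = (if p = q then 1 else 0)"
      using facts by (simp_all add: de_def trig_cscale)
  qed
  show ?thesis
  proof (rule that[of "kbound / m + L * kbound / m * (kbound / m)" e])
    have nn: "0 \<le> L * kbound / m * (kbound / m)" "0 \<le> kbound / m"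
      using L kbound_nonneg m(1) by auto
    then show "0 \<le> kbound / m + L * kbound / m * (kbound / m)" by simp
    show "norm (e i) \<le> kbound / m + L * kbound / m * (kbound / m)" if "(i div 2) mod 9 \<in> residues9" for i
      using va[OF that] de[OF that] nn by (auto simp: e_def)
    show "trig (i mod 2) (node (i div 2)) (e j) = (if i = j then 1 else 0)"
      if i: "(i div 2) mod 9 \<in> residues9" and j: "(j div 2) mod 9 \<in> residues9" for i j
    proof -
      have eq: "i = j \<longleftrightarrow> i div 2 = j div 2 \<and> (even i \<longleftrightarrow> even j)"
        by (metis div_mult_mod_eq even_iff_mod_2_eq_zero odd_iff_mod_2_eq_one)
      show ?thesis
        using cross[OF i j] by (cases "even i"; cases "even j") (auto simp: e_def eq even_iff_mod_2_eq_zero odd_iff_mod_2_eq_one simp flip: One_nat_def)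
    qed
  qed
qed

section \<open>Self-dual functions with prescribed values at the nodes\<close>

text \<open>The damping 1/10 is small enough that |tau|^2 <= 75/81 + 1/100 < 1 for k <= 10 and theta
  in [0, 1].\<close>

definition tau :: "nat \<Rightarrow> real \<Rightarrow> complex" where
  "tau k \<theta> = of_real (freq k * \<theta>) + \<i> / 10"

definition tau' :: "nat \<Rightarrow> real \<Rightarrow> complex" where
  "tau' k \<theta> = - 1 / tau k \<theta>"

definition direct_part :: "nat \<Rightarrow> real \<Rightarrow> dens \<Rightarrow> complex" where
  "direct_part = gdens 10 (\<lambda>_ _. 1) tau"

text \<open>The Fourier transform of \<open>direct_part\<close>, by
  \<open>fourier_direct_part\<close>.\<close>

definition dual_part :: "nat \<Rightarrow> real \<Rightarrow> dens \<Rightarrow> complex" where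
  "dual_part = gdens 10 (\<lambda>k \<theta>. \<i> / tau k \<theta>) tau'"

lemma Im_tau [simp]: "Im (tau k \<theta>) = 1 / 10"
  by (simp add: tau_def)

lemma tau_nonzero [simp]: "tau k \<theta> \<noteq> 0"
  using Im_tau[of k \<theta>] by (metis Im_tau zero_complex.simps(2) zero_neq_numeral divide_eq_0_iff zero_neq_one)

lemma continuous_on_tau: "continuous_on S (tau k)"
  unfolding tau_def by (intro continuous_intros)

lemma continuous_on_tau': "continuous_on S (tau' k)"
  unfolding tau'_def by (intro continuous_intros continuous_on_tau) simp

lemma norm_tau_ge: "1 / 10 \<le> norm (tau k \<theta>)"
  using abs_Im_le_cmod[of "tau k \<theta>"] by simp

lemma abs_freq_le: "k \<le> 10 \<Longrightarrow> \<bar>freq k\<bar>\<^sup>2 \<le> 75 / 81"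
proof -
  assume "k \<le> 10"
  then have "\<bar>real k - 5\<bar> \<le> 5" by auto
  then have "(real k - 5)\<^sup>2 \<le> 5\<^sup>2" using abs_le_square_iff[of "real k - 5" 5] by simp
  then show ?thesis by (simp add: freq_def power_divide power_mult_distrib)
qed

text \<open>This is where the density of the residues enters: the frequencies satisfy
  \<open>\<bar>freq k\<bar> < 1\<close>, so that inversion pushes the segment away from the real axis.\<close>

lemma norm_tau_less: "k \<le> 10 \<Longrightarrow> \<theta> \<in> {0..1} \<Longrightarrow> (norm (tau k \<theta>))\<^sup>2 \<le> 937 / 1000"
proof -
  assume k: "k \<le> 10" and \<theta>: "\<theta> \<in> {0..1}"
  have "(norm (tau k \<theta>))\<^sup>2 = (freq k * \<theta>)\<^sup>2 + 1 / 100"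
    by (simp add: cmod_power2 tau_def power_divide)
  moreover have "(freq k * \<theta>)\<^sup>2 \<le> (freq k)\<^sup>2 * 1"
    unfolding power_mult_distrib using \<theta> by (intro mult_left_mono) (auto simp: power_le_one)
  ultimately show ?thesis using abs_freq_le[OF k] by simp
qed

text \<open>Im(-1/tau) = Im tau / |tau|^2 exceeds Im tau = 1/10 by a fixed margin: 53/500 = 1/10 +
  3/500.\<close>

lemma Im_tau'_ge: "k \<le> 10 \<Longrightarrow> \<theta> \<in> {0..1} \<Longrightarrow> 53 / 500 \<le> Im (tau' k \<theta>)"
proof -
  assume k: "k \<le> 10" and \<theta>: "\<theta> \<in> {0..1}"
  have n: "0 < (norm (tau k \<theta>))\<^sup>2" by simp
  have "Im (tau' k \<theta>) = (1 / 10) / (norm (tau k \<theta>))\<^sup>2"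
    by (simp add: tau'_def Im_divide cmod_power2)
  moreover have "53 / 500 * (norm (tau k \<theta>))\<^sup>2 \<le> 1 / 10"
    using norm_tau_less[OF k \<theta>] by simp
  ultimately show ?thesis by (simp only: pos_le_divide_eq[OF n])
qed

lemma norm_inverse_tau: "norm (tau' k \<theta>) \<le> 10" "norm (\<i> / tau k \<theta>) \<le> 10"
  using norm_tau_ge[of k \<theta>] by (simp_all add: tau'_def norm_divide field_simps)

text \<open>There are eleven segments, and Im tau = 1/10 bounds both |i/tau| and |tau'| by
  10.\<close>

lemma dual_part_bound:
  assumes u: "0 \<le> u"
  shows "norm (dual_part j u C) \<le> 11 * (10 * (10 * pi) ^ j * exp (- pi * (53 / 500) * u)) * norm C"
proof -
  have "norm (dual_part j u C) \<le> real (Suc 10) * (10 * (10 * pi) ^ j * exp (- pi * (53 / 500) * u)) * norm C"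
    unfolding dual_part_def gdens_def
  proof (rule norm_dens_pair)
    fix k :: nat and \<theta> :: real assume k: "k \<le> 10" and \<theta>: "\<theta> \<in> {0..1}"
    have "norm (exp (\<i> * of_real pi * tau' k \<theta> * of_real u)) = exp (- pi * Im (tau' k \<theta>) * u)"
      by (simp add: norm_exp_eq_Re)
    also have "\<dots> \<le> exp (- pi * (53 / 500) * u)"
      using mult_right_mono[OF Im_tau'_ge[OF k \<theta>] u] by (simp add: mult.assoc)
    finally have 1: "norm (exp (\<i> * of_real pi * tau' k \<theta> * of_real u)) \<le> exp (- pi * (53 / 500) * u)" .
    have 2: "norm ((\<i> * of_real pi * tau' k \<theta>) ^ j) \<le> (10 * pi) ^ j"
      unfolding norm_power by (rule power_mono) (use norm_inverse_tau(1)[of k \<theta>] in \<open>auto simp: norm_mult\<close>)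
    show "norm (\<i> / tau k \<theta> * (\<i> * of_real pi * tau' k \<theta>) ^ j * exp (\<i> * of_real pi * tau' k \<theta> * of_real u))
        \<le> 10 * (10 * pi) ^ j * exp (- pi * (53 / 500) * u)"
      unfolding norm_mult[of "_ * _ ^ _"] norm_mult[of "\<i> / tau k \<theta>"]
      by (intro mult_mono 1 2 norm_inverse_tau) auto
  qed (auto intro!: continuous_intros continuous_on_tau continuous_on_tau')
  then show ?thesis by simp
qed

lemma direct_part_has_vector_derivative: "((\<lambda>u. direct_part j u C) has_vector_derivative direct_part (Suc j) u C) (at u)"
  unfolding direct_part_def by (rule gdens_has_vector_derivative) (auto intro!: continuous_intros continuous_on_tau)

lemma dual_part_bounded_linear: "bounded_linear (dual_part j u)"
  unfolding dual_part_def by (rule gdens_bounded_linear) (auto intro!: continuous_intros continuous_on_tau continuous_on_tau')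

text \<open>The weight e^(pi u / 10) cancels the damping Im tau = 1/10 and leaves the real
  frequencies of \<open>trig\<close>.\<close>

lemma exp_times_direct: "of_real (exp (pi / 10 * u)) * direct_part 0 u C = trig 0 u C"
proof -
  have "of_real (exp (pi / 10 * u)) * integral {0..1} (\<lambda>\<theta>. C (k, \<theta>) * exp (\<i> * of_real pi * tau k \<theta> * of_real u)) =
      integral {0..1} (\<lambda>\<theta>. C (k, \<theta>) * exp (\<i> * of_real pi * of_real (freq k * \<theta>) * of_real u))" for k
  proof -
    have "of_real (exp (pi / 10 * u)) * exp (\<i> * of_real pi * tau k \<theta> * of_real u) = exp (\<i> * of_real pi * of_real (freq k * \<theta>) * of_real u)" for \<theta>
      by (simp add: tau_def exp_of_real[symmetric] exp_add[symmetric] algebra_simps)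
    then have "(\<lambda>\<theta>. C (k, \<theta>) * exp (\<i> * of_real pi * of_real (freq k * \<theta>) * of_real u)) =
        (\<lambda>\<theta>. of_real (exp (pi / 10 * u)) * (C (k, \<theta>) * exp (\<i> * of_real pi * tau k \<theta> * of_real u)))"
      by (metis (no_types, opaque_lifting) mult.left_commute)
    then show ?thesis by simp
  qed
  then show ?thesis
    by (simp add: direct_part_def trig_def gdens_def dens_pair_def sum_distrib_left)
qed

lemma has_vector_derivative_exp_mult:
  fixes f :: "real \<Rightarrow> complex"
  assumes "(f has_vector_derivative f') (at u)"
  shows "((\<lambda>u. of_real (exp (a * u)) * f u) has_vector_derivative of_real (exp (a * u)) * (f' + of_real a * f u)) (at u)"
proof -
  have "((\<lambda>u. complex_of_real (exp (a * u)) * f u) has_vector_derivative (of_real (exp (a * u)) * f' + of_real (a * exp (a * u)) * f u)) (at u)"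
    by (rule has_vector_derivative_mult[OF of_real_has_vector_derivative assms]) (auto intro!: derivative_eq_intros)
  then show ?thesis by (simp add: algebra_simps)
qed

lemma exp_times_direct': "of_real (exp (pi / 10 * u)) * (direct_part 1 u C + of_real (pi / 10) * direct_part 0 u C) = trig 1 u C"
proof -
  have "((\<lambda>u. trig 0 u C) has_vector_derivative of_real (exp (pi / 10 * u)) * (direct_part 1 u C + of_real (pi / 10) * direct_part 0 u C)) (at u)"
    using has_vector_derivative_exp_mult[OF direct_part_has_vector_derivative[of 0 C u], of "pi / 10"]
    unfolding exp_times_direct by simp
  then show ?thesis
    using trig_has_vector_derivative[of 0 C u] vector_derivative_unique_at by fastforce
qed

section \<open>The interpolation conditions and their solution\<close>

definition profile :: "nat \<Rightarrow> real \<Rightarrow> dens \<Rightarrow> complex" where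
  "profile j u C = direct_part j u C + dual_part j u C"

text \<open>The index \<open>2n\<close> stands for the value, and \<open>2n + 1\<close> for the derivative, of the function
  \<open>e\<^bsup>\<pi>u/10\<^esup> profile 0 u\<close> at \<open>u = node n\<close>.\<close>

definition perturbation :: "nat \<Rightarrow> dens \<Rightarrow> complex" where
  "perturbation i C = (let u = node (i div 2) in of_real (exp (pi / 10 * u)) *
      (if even i then dual_part 0 u C else dual_part 1 u C + of_real (pi / 10) * dual_part 0 u C))"

definition node_cond :: "nat \<Rightarrow> dens \<Rightarrow> complex" where
  "node_cond i C = trig (i mod 2) (node (i div 2)) C + perturbation i C"

lemma node_ge: "real n \<le> node n"
proof -
  have "sqrt 3 \<le> 2" by (rule real_le_lsqrt) auto
  then show ?thesis using mult_left_mono[of "sqrt 3" 2 "real n"] by (simp add: node_def field_simps)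
qed

text \<open>The weight grows like e^(pi u / 10) and the dual part decays like e^(-53 pi u / 500), so
  the product decays at rate 3 pi / 500; finally u >= i div 2.\<close>

lemma perturbation_bound:
  "norm (perturbation i C) \<le> (110 * (1 + 11 * pi) * exp (- (3 * pi / 500) * real (i div 2))) * norm C"
proof -
  define u where "u = node (i div 2)"
  have u: "real (i div 2) \<le> u" "0 \<le> u"
    using node_ge[of "i div 2"] by (auto simp: u_def intro: order_trans[OF of_nat_0_le_iff])
  let ?d = "exp (- pi * (53 / 500) * u) * norm C"
  have d0: "norm (dual_part 0 u C) \<le> 110 * ?d" and d1: "norm (dual_part 1 u C) \<le> 110 * (10 * pi) * ?d"
    using dual_part_bound[OF u(2), of 0 C] dual_part_bound[OF u(2), of 1 C] by simp_all
  have "norm (if even i then dual_part 0 u C else dual_part 1 u C + of_real (pi / 10) * dual_part 0 u C) \<le> 110 * (1 + 11 * pi) * ?d"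
  proof (cases "even i")
    case True
    have "110 * ?d \<le> 110 * (1 + 11 * pi) * ?d" by (intro mult_right_mono) auto
    from order_trans[OF d0 this] show ?thesis using True by (simp only: if_True)
  next
    case False
    have "norm (dual_part 1 u C + of_real (pi / 10) * dual_part 0 u C) \<le> norm (dual_part 1 u C) + pi / 10 * norm (dual_part 0 u C)"
      using norm_triangle_ineq[of "dual_part 1 u C" "of_real (pi / 10) * dual_part 0 u C"] by (simp add: norm_mult)
    also have "\<dots> \<le> 110 * (10 * pi) * ?d + pi / 10 * (110 * ?d)"
      by (intro add_mono d1 mult_left_mono d0) auto
    also have "\<dots> = 110 * (10 * pi + pi / 10) * ?d" by (simp add: algebra_simps)
    also have "\<dots> \<le> 110 * (1 + 11 * pi) * ?d" by (intro mult_right_mono) auto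
    finally show ?thesis using False by simp
  qed
  then have "norm (perturbation i C) \<le> exp (pi / 10 * u) * (110 * (1 + 11 * pi) * ?d)"
    unfolding perturbation_def Let_def u_def[symmetric] norm_mult by (intro mult_mono) auto
  also have "\<dots> = 110 * (1 + 11 * pi) * (exp (pi / 10 * u) * exp (- pi * (53 / 500) * u)) * norm C"
    by (simp add: mult_ac)
  also have "exp (pi / 10 * u) * exp (- pi * (53 / 500) * u) = exp (- (3 * pi / 500) * u)"
    by (simp add: exp_add[symmetric])
  also have "110 * (1 + 11 * pi) * exp (- (3 * pi / 500) * u) * norm C \<le>
      110 * (1 + 11 * pi) * exp (- (3 * pi / 500) * real (i div 2)) * norm C"
    using u by (intro mult_right_mono mult_left_mono) auto
  finally show ?thesis .
qed

lemma perturbation_linear: "linear (perturbation i)"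
proof -
  note [simp] = linear_add[OF bounded_linear.linear[OF dual_part_bounded_linear]] linear_scale[OF bounded_linear.linear[OF dual_part_bounded_linear]]
  show ?thesis
    by (rule linearI) (simp_all add: perturbation_def Let_def ring_distribs scaleR_conv_of_real mult_ac)
qed

lemma node_cond_cscale: "node_cond i (cscale z C) = z * node_cond i C"
  by (simp add: node_cond_def perturbation_def Let_def dual_part_def trig_cscale gdens_cscale algebra_simps)

lemma node_cond_diff: "node_cond i (C - D) = node_cond i C - node_cond i D"
  using linear_diff[OF perturbation_linear] linear_diff[OF bounded_linear.linear[OF trig_bounded_linear]]
  by (simp add: node_cond_def)

lemma node_cond_even: "node_cond (2 * n) C = of_real (exp (pi / 10 * node n)) * profile 0 (node n) C"
  by (simp add: node_cond_def perturbation_def profile_def Let_def distrib_left flip: exp_times_direct)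

lemma node_cond_odd: "node_cond (Suc (2 * n)) C =
    of_real (exp (pi / 10 * node n)) * (profile 1 (node n) C + of_real (pi / 10) * profile 0 (node n) C)"
  by (simp add: node_cond_def perturbation_def profile_def Let_def distrib_left flip: exp_times_direct'[unfolded One_nat_def])

text \<open>Beyond a large node the perturbations of the dual system have a small sum, so
  \<open>perturbed_biorthogonal_system\<close> applies with all other indices switched off.\<close>

lemma node_cond_interpolation:
  obtains R where "\<And>s. \<exists>C. \<forall>i. R \<le> i div 2 \<and> (i div 2) mod 9 \<in> residues9 \<longrightarrow> node_cond i C = (if i = s then 1 else 0)"
proof -
  obtain e :: "nat \<Rightarrow> dens" and B where B: "0 \<le> B" and e: "\<And>i. (i div 2) mod 9 \<in> residues9 \<Longrightarrow> norm (e i) \<le> B"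
    and biorth: "\<And>i j. (i div 2) mod 9 \<in> residues9 \<Longrightarrow> (j div 2) mod 9 \<in> residues9 \<Longrightarrow>
       trig (i mod 2) (node (i div 2)) (e j) = (if i = j then 1 else 0)"
    using trig_dual_system by metis
  define a where "a = 3 * pi / 500"
  \<comment> \<open>Rate a per node is a/2 per index; the factor e^(a/2) absorbs the rounding in i
    div 2.\<close>
  define K where "K = 110 * (1 + 11 * pi) * exp (a / 2)"
  define f where "f i = K * exp (- a / 2) ^ i" for i :: nat
  have a: "0 < a" by (simp add: a_def)
  have K: "0 \<le> K" by (simp add: K_def)
  have f: "summable f" unfolding f_def by (intro summable_mult summable_geometric) (simp add: a)
  have pf: "norm (perturbation i C) \<le> f i * norm C" for i C
  proof -
    have "- a * real (i div 2) \<le> a / 2 + real i * (- a / 2)"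
    proof -
      have "real i \<le> 2 * real (i div 2) + 1"
      proof -
        have "i \<le> 2 * (i div 2) + 1" by presburger
        then have "real i \<le> real (2 * (i div 2) + 1)" by (simp only: of_nat_le_iff)
        then show ?thesis by simp
      qed
      then have "a * real i \<le> a * (2 * real (i div 2) + 1)" using a by (intro mult_left_mono) auto
      then show ?thesis by (simp add: algebra_simps)
    qed
    then have "exp (- a * real (i div 2)) \<le> exp (a / 2) * exp (- a / 2) ^ i"
      by (simp add: exp_of_nat_mult[symmetric] exp_add[symmetric])
    then have "110 * (1 + 11 * pi) * exp (- a * real (i div 2)) \<le> f i"
      unfolding f_def K_def mult.assoc[of _ "exp (a / 2)"] by (intro mult_left_mono) auto
    then have "110 * (1 + 11 * pi) * exp (- a * real (i div 2)) * norm C \<le> f i * norm C"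
      by (rule mult_right_mono) simp
    then show ?thesis using perturbation_bound[of i C] unfolding a_def by linarith
  qed
  \<comment> \<open>The threshold 1/(B + 1) also covers B = 0.\<close>
  obtain N where N: "\<And>n. n \<ge> N \<Longrightarrow> norm (\<Sum>i. f (i + n)) < 1 / (B + 1)"
    using suminf_exist_split[of "1 / (B + 1)" f] f B by auto
  define I where "I = {i. N \<le> i div 2 \<and> (i div 2) mod 9 \<in> residues9}"
  \<comment> \<open>An index in \<open>I\<close> satisfies N <= i div 2 <= i, so the bounds survive
    truncation at N.\<close>
  define q where "q i = (if N \<le> i then f i else 0)" for i
  define \<psi> where "\<psi> i = (if i \<in> I then perturbation i else (\<lambda>_. 0))" for i
  define E where "E i z = (if i \<in> I then cscale z (e i) else 0)" for i z
  have f0: "0 \<le> f i" for i using K by (simp add: f_def)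
  have q: "summable q" by (rule summable_comparison_test'[OF f, of 0]) (use f0 in \<open>auto simp: q_def\<close>)
  have "suminf q = (\<Sum>i. q (i + N)) + sum q {..<N}" by (rule suminf_split_initial_segment[OF q])
  also have "\<dots> = (\<Sum>i. f (i + N))" by (simp add: q_def)
  finally have "suminf q < 1 / (B + 1)" using N[of N] by simp
  then have "B * suminf q \<le> B * (1 / (B + 1))" using B by (intro mult_left_mono) auto
  also have "\<dots> < 1" using B by simp
  finally have small: "B * suminf q < 1" .
  have "\<exists>C. \<forall>i. N \<le> i div 2 \<and> (i div 2) mod 9 \<in> residues9 \<longrightarrow> node_cond i C = (if i = s then 1 else 0)" for s
  proof -
    have "\<exists>C. \<forall>i\<in>I. trig (i mod 2) (node (i div 2)) C + \<psi> i C = (if i = s then 1 else 0)"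
    proof (rule perturbed_biorthogonal_system[where q = q and B = B and E = E])
      show "bounded_linear (trig (i mod 2) (node (i div 2)))" for i by (rule trig_bounded_linear)
      show "linear (\<psi> i)" for i using perturbation_linear by (simp add: \<psi>_def linear_zero)
      show "norm (\<psi> i v) \<le> q i * norm v" for i v
        using pf[of i v] f0[of i] div_le_dividend[of i 2] by (auto simp: \<psi>_def q_def I_def)
      show "E i (z - w) = E i z - E i w" for i z w
        by (auto simp: E_def left_diff_distrib intro!: bcontfun_eqI)
      show "norm (E i z) \<le> B * norm z" for i z
      proof (cases "i \<in> I")
        case True
        have "norm (cscale z (e i)) \<le> norm z * norm (e i)" by (rule norm_cscale)
        also have "\<dots> \<le> norm z * B" by (intro mult_left_mono e) (use True in \<open>auto simp: I_def\<close>)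
        finally show ?thesis using True by (simp add: E_def mult.commute)
      qed (use B in \<open>simp add: E_def\<close>)
      show "trig (i mod 2) (node (i div 2)) (E j z) = (if i = j then z else 0)" if "i \<in> I" for i j z
      proof (cases "j \<in> I")
        case True
        then show ?thesis using biorth[of i j] that by (simp add: E_def trig_cscale I_def)
      next
        case False
        then show ?thesis using that linear_0[OF bounded_linear.linear[OF trig_bounded_linear]] by (auto simp: E_def)
      qed
      show "0 \<le> q i" for i using f0 by (simp add: q_def)
    qed (use B q small in auto)
    then obtain C where "\<forall>i\<in>I. trig (i mod 2) (node (i div 2)) C + \<psi> i C = (if i = s then 1 else 0)" ..
    then show ?thesis by (intro exI[of _ C]) (auto simp: I_def \<psi>_def node_cond_def)
  qed
  then show ?thesis by (rule that)
qed

section \<open>Schwartz decay and Fourier self-duality of the profiles\<close>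

lemma rapid_profile_zero: "rapid_profile (\<lambda>_ _. 0)"
  by (auto simp: rapid_profile_def intro: exI[of _ 0])

lemma rapid_profile_add:
  assumes H: "rapid_profile H" and K: "rapid_profile K"
  shows "rapid_profile (\<lambda>j u. H j u + K j u)"
  unfolding rapid_profile_def
proof (intro conjI allI)
  show "((\<lambda>u. H j u + K j u) has_vector_derivative H (Suc j) u + K (Suc j) u) (at u)" for j u
    using H K by (intro has_vector_derivative_add) (auto simp: rapid_profile_def)
  fix j k :: nat
  obtain B where B: "\<And>u. u \<ge> 0 \<Longrightarrow> u ^ k * norm (H j u) \<le> B"
    using H unfolding rapid_profile_def by blast
  obtain D where D: "\<And>u. u \<ge> 0 \<Longrightarrow> u ^ k * norm (K j u) \<le> D"
    using K unfolding rapid_profile_def by blast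
  have "u ^ k * norm (H j u + K j u) \<le> B + D" if "u \<ge> 0" for u
  proof -
    have "u ^ k * norm (H j u + K j u) \<le> u ^ k * (norm (H j u) + norm (K j u))"
      by (intro mult_left_mono norm_triangle_ineq) (use that in auto)
    then show ?thesis using B[OF that] D[OF that] by (simp add: ring_distribs)
  qed
  then show "\<exists>B. \<forall>u\<ge>0. u ^ k * norm (H j u + K j u) \<le> B" by blast
qed

lemma rapid_profile_sum:
  "finite A \<Longrightarrow> (\<And>k. k \<in> A \<Longrightarrow> rapid_profile (H k)) \<Longrightarrow> rapid_profile (\<lambda>j u. \<Sum>k\<in>A. H k j u)"
  by (induction A rule: finite_induct) (auto intro: rapid_profile_zero rapid_profile_add)

lemma Im_tau'_pos: "0 < Im (tau' k \<theta>)"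
proof -
  have "Im (tau' k \<theta>) = (1 / 10) / (norm (tau k \<theta>))\<^sup>2"
    by (simp add: tau'_def Im_divide cmod_power2)
  then show ?thesis by simp
qed

lemma rapid_profile_profile: "rapid_profile (\<lambda>j u. profile j u C)"
  unfolding profile_def direct_part_def dual_part_def gdens_gsup
  by (intro rapid_profile_add rapid_profile_sum rapid_profile_gsup continuous_on_mult continuous_on_dens
      continuous_on_tau continuous_on_tau') (auto intro!: continuous_intros continuous_on_tau Im_tau'_pos)

lemma fourier_sum:
  assumes "finite A"
    and "\<And>k. k \<in> A \<Longrightarrow> integrable lborel (\<lambda>x. f k x * exp (2 * complex_of_real pi * \<i> * complex_of_real (x \<bullet> \<xi>)))"
  shows "fourier (\<lambda>x. \<Sum>k\<in>A. f k x) \<xi> = (\<Sum>k\<in>A. fourier (f k) \<xi>)"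
  unfolding fourier_def sum_distrib_right by (rule Bochner_Integration.integral_sum) (use assms in auto)

lemma fourier_direct_part:
  "fourier (\<lambda>x. direct_part 0 ((norm x)\<^sup>2) C) \<xi> = dual_part 0 ((norm \<xi>)\<^sup>2) C"
  "integrable lborel (\<lambda>x. direct_part 0 ((norm x)\<^sup>2) C * exp (2 * complex_of_real pi * \<i> * complex_of_real (x \<bullet> \<xi>)))"
proof -
  have c: "continuous_on {0..1} (\<lambda>\<theta>. C (k, \<theta>) * 1)" for k
    by (intro continuous_on_mult continuous_on_dens continuous_on_const)
  note F = fourier_gsup[OF c continuous_on_tau]
  have "fourier (\<lambda>x. direct_part 0 ((norm x)\<^sup>2) C) \<xi> = (\<Sum>k\<le>10. fourier (\<lambda>x. gsup (\<lambda>\<theta>. C (k, \<theta>) * 1) (tau k) 0 ((norm x)\<^sup>2)) \<xi>)"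
    unfolding direct_part_def gdens_gsup by (rule fourier_sum, simp, rule F(1), simp)
  also have "\<dots> = dual_part 0 ((norm \<xi>)\<^sup>2) C"
    unfolding dual_part_def gdens_gsup by (intro sum.cong refl, subst F(2)) (simp_all add: tau'_def[abs_def])
  finally show "fourier (\<lambda>x. direct_part 0 ((norm x)\<^sup>2) C) \<xi> = dual_part 0 ((norm \<xi>)\<^sup>2) C" .
  show "integrable lborel (\<lambda>x. direct_part 0 ((norm x)\<^sup>2) C * exp (2 * complex_of_real pi * \<i> * complex_of_real (x \<bullet> \<xi>)))"
    unfolding direct_part_def gdens_gsup sum_distrib_right by (intro Bochner_Integration.integrable_sum F(1)) simp
qed

text \<open>Inversion is an involution, -1/tau' = tau, and the weights multiply to (i/tau)(i/tau') =
  1, so a second transform returns the direct part.\<close>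

lemma fourier_dual_part:
  "fourier (\<lambda>x. dual_part 0 ((norm x)\<^sup>2) C) \<xi> = direct_part 0 ((norm \<xi>)\<^sup>2) C"
  "integrable lborel (\<lambda>x. dual_part 0 ((norm x)\<^sup>2) C * exp (2 * complex_of_real pi * \<i> * complex_of_real (x \<bullet> \<xi>)))"
proof -
  have c: "continuous_on {0..1} (\<lambda>\<theta>. C (k, \<theta>) * (\<i> / tau k \<theta>))" for k
    by (intro continuous_on_mult continuous_on_dens continuous_on_divide continuous_on_const continuous_on_tau) simp
  note F = fourier_gsup[OF c continuous_on_tau' Im_tau'_pos]
  have "fourier (\<lambda>x. dual_part 0 ((norm x)\<^sup>2) C) \<xi> = (\<Sum>k\<le>10. fourier (\<lambda>x. gsup (\<lambda>\<theta>. C (k, \<theta>) * (\<i> / tau k \<theta>)) (tau' k) 0 ((norm x)\<^sup>2)) \<xi>)"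
    unfolding dual_part_def gdens_gsup by (rule fourier_sum, simp, rule F(1))
  also have "\<dots> = direct_part 0 ((norm \<xi>)\<^sup>2) C"
  proof -
    have 1: "(\<lambda>\<theta>. C (k, \<theta>) * (\<i> / tau k \<theta>) * (\<i> / tau' k \<theta>)) = (\<lambda>\<theta>. C (k, \<theta>) * 1)"
      and 2: "(\<lambda>\<theta>. - 1 / tau' k \<theta>) = tau k" for k
      by (auto simp: tau'_def fun_eq_iff)
    show ?thesis unfolding direct_part_def gdens_gsup F(2) 1 2 ..
  qed
  finally show "fourier (\<lambda>x. dual_part 0 ((norm x)\<^sup>2) C) \<xi> = direct_part 0 ((norm \<xi>)\<^sup>2) C" .
  show "integrable lborel (\<lambda>x. dual_part 0 ((norm x)\<^sup>2) C * exp (2 * complex_of_real pi * \<i> * complex_of_real (x \<bullet> \<xi>)))"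
    unfolding dual_part_def gdens_gsup sum_distrib_right by (intro Bochner_Integration.integrable_sum F(1))
qed

definition radial_fun :: "dens \<Rightarrow> real^2 \<Rightarrow> complex" where
  "radial_fun C x = profile 0 ((norm x)\<^sup>2) C"

text \<open>The transform exchanges the two summands of the profile.\<close>

lemma fourier_radial_fun: "fourier (radial_fun C) = radial_fun C"
proof
  fix \<xi>
  have "fourier (radial_fun C) \<xi> = fourier (\<lambda>x. direct_part 0 ((norm x)\<^sup>2) C) \<xi> + fourier (\<lambda>x. dual_part 0 ((norm x)\<^sup>2) C) \<xi>"
    unfolding fourier_def radial_fun_def profile_def ring_distribs
    by (rule Bochner_Integration.integral_add fourier_direct_part(2) fourier_dual_part(2))+
  then show "fourier (radial_fun C) \<xi> = radial_fun C \<xi>"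
    by (simp add: fourier_direct_part fourier_dual_part radial_fun_def profile_def)
qed

lemma schwartz_radial_fun: "schwartz (radial_fun C)"
  using schwartz_radial_profile[OF rapid_profile_profile] unfolding radial_fun_def[abs_def] .

lemma radial_radial_fun: "radial (radial_fun C)"
  by (auto simp: radial_def radial_fun_def)

text \<open>The weight e^(pi u / 10) is nonzero, so the even condition annihilates the profile at
  the node, and the odd condition then annihilates its derivative.\<close>

lemma vanishes_radial_fun:
  assumes "node_cond (2 * m) C = 0" "node_cond (Suc (2 * m)) C = 0"
  shows "vanishes_order2_at_radius (radial_fun C) (sqrt (2 * real_of_int (int m) / sqrt 3))"
proof -
  have r: "(sqrt (2 * real_of_int (int m) / sqrt 3))\<^sup>2 = node m" by (simp add: node_def)
  have p: "profile 0 (node m) C = 0" "profile 1 (node m) C = 0"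
    using assms by (simp_all add: node_cond_even node_cond_odd)
  have "((\<lambda>u. profile 0 u C) has_vector_derivative profile 1 (node m) C) (at (node m))"
    using rapid_profile_profile[of C] by (auto simp: rapid_profile_def)
  then have "((\<lambda>u. profile 0 u C) has_vector_derivative 0) (at (node m) within {0..})"
    unfolding p(2) by (rule has_vector_derivative_at_within)
  then show ?thesis
    unfolding vanishes_order2_at_radius_def r
    by (intro exI[of _ "\<lambda>u. profile 0 u C"]) (simp add: radial_fun_def p)
qed

section \<open>Residues of x^2 + xy + y^2\<close>

lemma loeschian_mod:
  fixes x y :: int
  shows "(x\<^sup>2 + x * y + y\<^sup>2) mod 9 \<in> {0, 1, 3, 4, 7}" and "(x\<^sup>2 + x * y + y\<^sup>2) mod 25 \<noteq> 5"
    and "0 \<le> x\<^sup>2 + x * y + y\<^sup>2"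
proof -
  have m: "(x\<^sup>2 + x * y + y\<^sup>2) mod k = ((x mod k)\<^sup>2 + (x mod k) * (y mod k) + (y mod k)\<^sup>2) mod k" for k
    unfolding power2_eq_square by (intro mod_add_cong mod_mult_cong) simp_all
  have "\<forall>a\<in>set [0..8]. \<forall>b\<in>set [0..8]. (a\<^sup>2 + a * b + b\<^sup>2) mod 9 \<in> {0, 1, 3, 4, 7 :: int}" by code_simp
  moreover have "x mod 9 \<in> set [0..8]" "y mod 9 \<in> set [0..8]" by auto
  ultimately show "(x\<^sup>2 + x * y + y\<^sup>2) mod 9 \<in> {0, 1, 3, 4, 7}" unfolding m[of 9] by blast
  show "(x\<^sup>2 + x * y + y\<^sup>2) mod 25 \<noteq> 5"
  proof
    \<comment> \<open>The form represents 0 modulo 5 only trivially, so a value divisible by 5 has 5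
      dividing x and y, and is then divisible by 25.\<close>
    assume 5: "(x\<^sup>2 + x * y + y\<^sup>2) mod 25 = 5"
    have "(x\<^sup>2 + x * y + y\<^sup>2) mod 5 = (x\<^sup>2 + x * y + y\<^sup>2) mod 25 mod 5" by (simp add: mod_mod_cancel)
    then have "((x mod 5)\<^sup>2 + (x mod 5) * (y mod 5) + (y mod 5)\<^sup>2) mod 5 = 0" using 5 m[of 5] by simp
    moreover have "\<forall>a\<in>set [0..4]. \<forall>b\<in>set [0..4]. (a\<^sup>2 + a * b + b\<^sup>2) mod 5 = (0 :: int) \<longrightarrow> a = 0 \<and> b = 0" by code_simp
    from this[THEN bspec, of "x mod 5", THEN bspec, of "y mod 5"]
    have "((x mod 5)\<^sup>2 + (x mod 5) * (y mod 5) + (y mod 5)\<^sup>2) mod 5 = 0 \<longrightarrow> x mod 5 = 0 \<and> y mod 5 = 0" by simp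
    ultimately have "x mod 5 = 0 \<and> y mod 5 = 0" by (rule mp[rotated])
    then obtain k l where "x = 5 * k" "y = 5 * l" by (auto simp: mod_eq_0_iff_dvd elim!: dvdE)
    then have "x\<^sup>2 + x * y + y\<^sup>2 = 25 * (k\<^sup>2 + k * l + l\<^sup>2)" by (simp add: power2_eq_square algebra_simps)
    then show False using 5 by simp
  qed
  have "4 * (x\<^sup>2 + x * y + y\<^sup>2) = (2 * x + y)\<^sup>2 + 3 * y\<^sup>2" by (simp add: power2_eq_square algebra_simps)
  then show "0 \<le> x\<^sup>2 + x * y + y\<^sup>2" by (smt (verit) zero_le_power2)
qed

definition loeschian :: "nat set" where
  "loeschian = {n. \<exists>x y :: int. int n = x\<^sup>2 + x * y + y\<^sup>2}"

lemma loeschian_residue: "n \<in> loeschian \<Longrightarrow> n mod 9 \<in> residues9"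
proof -
  assume "n \<in> loeschian"
  then obtain x y :: int where "int n = x\<^sup>2 + x * y + y\<^sup>2" by (auto simp: loeschian_def)
  then have "int n mod 9 \<in> {0, 1, 3, 4, 7}" using loeschian_mod(1)[of x y] by simp
  moreover have "int n mod 9 = int (n mod 9)" by (simp add: zmod_int)
  ultimately show ?thesis by (auto simp: residues9_def)
qed

lemma not_loeschian: "n mod 25 = 5 \<Longrightarrow> n \<notin> loeschian"
proof
  assume "n mod 25 = 5" "n \<in> loeschian"
  then obtain x y :: int where "int n = x\<^sup>2 + x * y + y\<^sup>2" by (auto simp: loeschian_def)
  then have "int n mod 25 \<noteq> 5" using loeschian_mod(2) by simp
  moreover have "int n mod 25 = int (n mod 25)" by (simp add: zmod_int)
  ultimately show False using \<open>n mod 25 = 5\<close> by simp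
qed

text \<open>Finitely many linear conditions are imposed on a sequence with a diagonal structure
  by combining its members two at a time.\<close>

lemma diagonal_sequence_kill:
  fixes L :: "nat \<Rightarrow> 'v::ab_group_add \<Rightarrow> complex" and sc :: "complex \<Rightarrow> 'v \<Rightarrow> 'v"
  assumes L: "\<And>i v w. L i (v - w) = L i v - L i w" "\<And>i z v. L i (sc z v) = z * L i v"
    and "finite F" and "\<And>b :: nat. L (s b) (v b) \<noteq> 0" "\<And>a b. a \<noteq> b \<Longrightarrow> L (s a) (v b) = 0" "\<And>i b. i \<in> Z \<Longrightarrow> L i (v b) = 0"
  shows "\<exists>(t :: nat \<Rightarrow> nat) w. range t \<subseteq> range s \<and> (\<forall>b. L (t b) (w b) \<noteq> 0) \<and>
    (\<forall>a b. a \<noteq> b \<longrightarrow> L (t a) (w b) = 0) \<and> (\<forall>i\<in>Z \<union> F. \<forall>b. L i (w b) = 0)"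
  using \<open>finite F\<close>
proof (induction F rule: finite_induct)
  case empty
  show ?case using assms(4-6) by (intro exI[of _ s] exI[of _ v]) auto
next
  case (insert i F)
  then obtain t :: "nat \<Rightarrow> nat" and w where t: "range t \<subseteq> range s" and d: "\<And>b. L (t b) (w b) \<noteq> 0"
    and o: "\<And>a b. a \<noteq> b \<Longrightarrow> L (t a) (w b) = 0" and z: "\<And>j b. j \<in> Z \<union> F \<Longrightarrow> L j (w b) = 0"
    by blast
  \<comment> \<open>The combination of the members 2b and 2b + 1 is annihilated by L i. Its entry at
    t (2b + 1) is -L i (w (2b)) times a nonzero diagonal entry; if L i (w (2b)) is already 0, the
    member 2b is kept with its own index.\<close>
  define w' where "w' b = (if L i (w (2 * b)) = 0 then w (2 * b)
      else sc (L i (w (Suc (2 * b)))) (w (2 * b)) - sc (L i (w (2 * b))) (w (Suc (2 * b))))" for b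
  define t' where "t' b = (if L i (w (2 * b)) = 0 then t (2 * b) else t (Suc (2 * b)))" for b
  have ne: "2 * a \<noteq> Suc (2 * b)" "Suc (2 * a) \<noteq> 2 * b" for a b :: nat by presburger+
  show ?case
  proof (intro exI[of _ t'] exI[of _ w'] conjI allI ballI impI)
    show "range t' \<subseteq> range s" using t by (auto simp: t'_def)
    show "L (t' b) (w' b) \<noteq> 0" for b using d o[OF ne(2)] by (auto simp: t'_def w'_def L)
    show "L (t' a) (w' b) = 0" if "a \<noteq> b" for a b
      using that o[OF ne(1)] o[OF ne(2)] o by (auto simp: t'_def w'_def L)
    show "L j (w' b) = 0" if "j \<in> Z \<union> insert i F" for j b
      using that z by (auto simp: w'_def L mult.commute)
  qed
qed

theorem theorem1p9:
  "\<exists>S :: (real^2 \<Rightarrow> complex) set.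
     infinite S \<and> cfun.independent S \<and>
     (\<forall>f\<in>S. radial f \<and> schwartz f \<and>
        (\<forall>n::int. (\<exists>x y::int. n = x\<^sup>2 + x * y + y\<^sup>2) \<longrightarrow>
           vanishes_order2_at_radius f (sqrt (2 * real_of_int n / sqrt 3)) \<and>
           vanishes_order2_at_radius (fourier f) (sqrt (2 * real_of_int n / sqrt 3))))"
proof -
  obtain R where R: "\<And>s. \<exists>C. \<forall>i. R \<le> i div 2 \<and> (i div 2) mod 9 \<in> residues9 \<longrightarrow> node_cond i C = (if i = s then 1 else 0)"
    using node_cond_interpolation by metis
  \<comment> \<open>An even index is a value condition. 55 is 1 modulo 9, an admissible residue, and
    5 modulo 25, hence not of the form x^2 + xy + y^2. Steps of 225 = 9 * 25 preserve both, and the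
    summand R puts the node beyond R.\<close>
  define s where "s b = 2 * (55 + 225 * (R + b))" for b :: nat
  have s2: "s b div 2 = 55 + 225 * (R + b)" for b by (simp add: s_def)
  have s9: "(s b div 2) mod 9 = 1" and s25: "(s b div 2) mod 25 = 5" for b
    unfolding s2 by presburger+
  obtain v where v: "\<And>b i. R \<le> i div 2 \<Longrightarrow> (i div 2) mod 9 \<in> residues9 \<Longrightarrow> node_cond i (v b) = (if i = s b then 1 else 0)"
    using R[of "s _"] by metis
  \<comment> \<open>The conditions in \<open>Z\<close> hold for every \<open>v b\<close> by
    construction. Nodes below R have indices below 2 R, which form the finite set to be
    removed.\<close>
  define Z where "Z = {i. R \<le> i div 2 \<and> i div 2 \<in> loeschian}"
  have "\<exists>(t :: nat \<Rightarrow> nat) w. range t \<subseteq> range s \<and> (\<forall>b. node_cond (t b) (w b) \<noteq> 0) \<and>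
    (\<forall>a b. a \<noteq> b \<longrightarrow> node_cond (t a) (w b) = 0) \<and> (\<forall>i\<in>Z \<union> {..<2 * R}. \<forall>b. node_cond i (w b) = 0)"
  proof (rule diagonal_sequence_kill[where s = s and v = v and sc = cscale])
    have c: "node_cond (s a) (v b) = (if s a = s b then 1 else 0)" for a b
      by (rule v) (use s9[of a] in \<open>auto simp: s2 residues9_def\<close>)
    show "node_cond (s b) (v b) \<noteq> 0" for b by (simp add: c)
    show "node_cond (s a) (v b) = 0" if "a \<noteq> b" for a b using that by (simp add: c) (simp add: s_def)
    show "node_cond i (v b) = 0" if "i \<in> Z" for i b
    proof -
      have "i \<noteq> s b" using that not_loeschian[OF s25[of b]] by (auto simp: Z_def)
      then show ?thesis using that v[of i b] loeschian_residue by (auto simp: Z_def)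
    qed
  qed (simp_all add: node_cond_diff node_cond_cscale)
  then obtain t :: "nat \<Rightarrow> nat" and w where tw: "range t \<subseteq> range s \<and> (\<forall>b. node_cond (t b) (w b) \<noteq> 0) \<and>
    (\<forall>a b. a \<noteq> b \<longrightarrow> node_cond (t a) (w b) = 0) \<and> (\<forall>i\<in>Z \<union> {..<2 * R}. \<forall>b. node_cond i (w b) = 0)"
    by (elim exE)
  have t: "range t \<subseteq> range s" and d: "\<And>b. node_cond (t b) (w b) \<noteq> 0"
    and o: "\<And>a b. a \<noteq> b \<Longrightarrow> node_cond (t a) (w b) = 0"
    and z: "\<And>i b. i \<in> Z \<union> {..<2 * R} \<Longrightarrow> node_cond i (w b) = 0"
    using tw by simp_all
  have z': "node_cond i (w b) = 0" if "i div 2 \<in> loeschian" for i b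
    by (rule z) (use that in \<open>auto simp: Z_def\<close>)
  define F where "F b = radial_fun (w b)" for b
  have "\<exists>x. \<forall>b. F b x = 0 \<longleftrightarrow> node_cond (t a) (w b) = 0" for a
  proof -
    \<comment> \<open>The surviving indices lie in the range of \<open>s\<close> and so are even:
      each tests the profile at one node, that is, \<open>F b\<close> at a point with that squared
      norm.\<close>
    have "t a \<in> range s" using t by blast
    then obtain n where n: "t a = 2 * n" unfolding s_def by blast
    obtain x :: "real^2" where "norm x = sqrt (node n)"
      using vector_choose_size[of "sqrt (node n)"] by (auto simp: node_def)
    then have "(norm x)\<^sup>2 = node n" by (simp add: node_def)
    then show ?thesis by (intro exI[of _ x]) (simp add: F_def radial_fun_def n node_cond_even)
  qed
  then obtain p where p: "\<And>a b. F b (p a) = 0 \<longleftrightarrow> node_cond (t a) (w b) = 0" by metis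
  have Fd: "F b (p b) \<noteq> 0" for b using p d by blast
  have Fo: "F b (p a) = 0" if "a \<noteq> b" for a b using p o[OF that] by blast
  have inj: "inj F"
    by (rule injI) (metis Fd Fo)
  have "cfun.independent (range F)"
    unfolding cfun.independent_explicit_module
  proof (intro allI impI)
    fix T u f assume T: "finite T" "T \<subseteq> range F" and sum0: "(\<Sum>f\<in>T. (\<lambda>x. u f * f x)) = 0" and f: "f \<in> T"
    obtain b where b: "f = F b" using T f by blast
    have ev: "(\<Sum>f\<in>T. (\<lambda>x. u f * f x)) y = (\<Sum>f\<in>T. u f * f y)" for y
      using T(1) by (induction T rule: finite_induct) auto
    have "g (p b) = 0" if g: "g \<in> T - {f}" for g
    proof -
      obtain c where "g = F c" using g T(2) by blast
      then show ?thesis using g b Fo[of b c] by auto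
    qed
    then have "(\<Sum>g\<in>T - {f}. u g * g (p b)) = 0"
      by (intro sum.neutral) simp
    then have "(\<Sum>g\<in>T. u g * g (p b)) = u f * f (p b)"
      using T(1) f by (simp add: sum.remove[of T f])
    then show "u f = 0" using ev[of "p b"] sum0 Fd[of b] b by simp
  qed
  moreover have "infinite (range F)" using inj by (simp add: range_inj_infinite)
  moreover have "radial f \<and> schwartz f \<and>
        (\<forall>n::int. (\<exists>x y::int. n = x\<^sup>2 + x * y + y\<^sup>2) \<longrightarrow>
           vanishes_order2_at_radius f (sqrt (2 * real_of_int n / sqrt 3)) \<and>
           vanishes_order2_at_radius (fourier f) (sqrt (2 * real_of_int n / sqrt 3)))" if f: "f \<in> range F" for f
  proof -
    obtain b where b: "f = radial_fun (w b)" using f by (auto simp: F_def)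
    have "vanishes_order2_at_radius f (sqrt (2 * real_of_int n / sqrt 3))"
      if n: "\<exists>x y::int. n = x\<^sup>2 + x * y + y\<^sup>2" for n :: int
    proof -
      have "0 \<le> n" using n loeschian_mod(3) by auto
      then obtain m where m: "n = int m" by (metis nonneg_int_cases)
      then have "m \<in> loeschian" using n by (simp add: loeschian_def)
      then show ?thesis unfolding b m by (intro vanishes_radial_fun z') simp_all
    qed
    \<comment> \<open>Each f is its own Fourier transform, so the two vanishing conditions
      coincide.\<close>
    then show ?thesis
      using b by (simp add: fourier_radial_fun radial_radial_fun schwartz_radial_fun)
  qed
  ultimately show ?thesis by blast
qed

end
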